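(* Let $$X(t)=\sum_{\ell=0}^\infty\sum_{m=-\ell}^{\ell}\Big(e^{-\ell(\ell+1)t}X^0_{\ell,m}+\int_0^t e^{-\ell(\ell+1)(t-s)}\,\mathrm{d}L_{\ell,m}(s)\Big)Y_{\ell,m}$$ and, for $\kappa\in\mathbb{N}$, let $X^{(\kappa)}(t)$ be its spectral approximation, i.e. the same expression with the sum over $\ell$ truncated to $0\le\ell\le\kappa$. Assume that one of the following holds: (a) $L\in L^2(\Omega,H^\eta(\mathbb{S}^2))$ for some $\eta\in(-1,\infty)$ with expansion $L(t)=\sum_{\ell,m}L_{\ell,m}(t)Y_{\ell,m}$ converging in $L^2(\Omega,H^\eta(\mathbb{S}^2))$, i.e. $\sum_{\ell=0}^\infty\sum_{m=-\ell}^\ell(1+\ell(\ell+1))^\eta(v_{\ell,m}+\widetilde m_{\ell,m}^2)<\infty$; in this case set $\beta=\eta+1$; (b) for some $\alpha>0$, $L_{\ell,m}=a_\ell\hat L_{\ell,m}$ for all $\ell,m$, where $a_0\ge0$, $|a_\ell|\le C'\ell^{-\alpha/2}$ for all $\ell\in\mathbb{N}$ and some constant $C'$, and $(\hat L_{\ell,m})_{\ell\in\mathbb{N}_0,m\in\{-\ell,\dots,\ell\}}$ is a sequence of identically distributed real-valued Lévy processes with mean $\mathbb{E}[\hat L_{\ell,m}(t)]=t\hat m$ and variance $\mathbb{E}[(\hat L_{\ell,m}(t)-\mathbb{E}[\hat L_{\ell,m}(t)])^2]=t\hat v$; in this case set $\beta=\alpha/2$. Then there is a finite constant $C$, independent of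 $\kappa$ and $t$, such that for all $\kappa\in\mathbb{N}$ and $t\in[0,T]$ $$\|X(t)-X^{(\kappa)}(t)\|_{L^2(\Omega,L^2(\mathbb{S}^2))}\le e^{-(\kappa+1)^2t}\,\|X^0\|_{L^2(\Omega,L^2(\mathbb{S}^2))}+C\kappa^{-\beta}.$$
   Context: $\mathbb{S}^2$ is the unit sphere in $\mathbb{R}^3$ with surface measure, $\Delta_{\mathbb{S}^2}$ its Laplace--Beltrami operator, and $(Y_{\ell,m})_{\ell\in\mathbb{N}_0,\,m\in\{-\ell,\dots,\ell\}}$ the real-valued spherical harmonics, an orthonormal basis of $L^2(\mathbb{S}^2)$ with $\Delta_{\mathbb{S}^2}Y_{\ell,m}=-\ell(\ell+1)Y_{\ell,m}$. For $\eta\in\mathbb{R}$, $H^\eta(\mathbb{S}^2)=(\mathrm{Id}-\Delta_{\mathbb{S}^2})^{-\eta/2}L^2(\mathbb{S}^2)$ (distributions for $\eta<0$), with norm $\|f\|_{H^\eta(\mathbb{S}^2)}^2=\sum_{\ell,m}(1+\ell(\ell+1))^\eta f_{\ell,m}^2$ for $f=\sum_{\ell,m}f_{\ell,m}Y_{\ell,m}$; $H^0=L^2$. $\|Z\|_{L^p(\Omega,H^\eta(\mathbb{S}^2))}=\mathbb{E}[\|Z\|_{H^\eta(\mathbb{S}^2)}^p]^{1/p}$. $(\Omega,\mathcal{F},(\mathcal{F}_t)_{t\in[0,T]},\mathbb{P})$ is a complete filtered probability space, $T<\infty$. $L$ is a square-integrable Lévy process (stationary independent increments, stochastically continuous, $L(0)=0$,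 càdlàg) with values in $H^\eta(\mathbb{S}^2)$ for some $\eta\in(-1,\infty)$, expanded as $L(t)=\sum_{\ell,m}L_{\ell,m}(t)Y_{\ell,m}$ with real-valued càdlàg Lévy processes $L_{\ell,m}$ (in general not assumed independent). Set $\widetilde m_{\ell,m}=\mathbb{E}[L_{\ell,m}(1)]$ and $v_{\ell,m}=\mathbb{E}[(L_{\ell,m}(1)-\mathbb{E}[L_{\ell,m}(1)])^2]$. The initial value $X^0\in L^2(\Omega,L^2(\mathbb{S}^2))$ is $\mathcal{F}_0$-measurable and independent of $L$, and $X^0_{\ell,m}=\langle X^0,Y_{\ell,m}\rangle_{L^2(\mathbb{S}^2)}$. $X$ is the mild solution of $\mathrm{d}X(t)=\Delta_{\mathbb{S}^2}X(t)\,\mathrm{d}t+\mathrm{d}L(t)$, $X(0)=X^0$. *)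

theory Defs
  imports "HOL-Probability.Probability"
begin

section \<open>Random variables with values in a seminormed space of functions\<close>

text \<open>
  The Hilbert spaces \<open>L\<^sup>2(S\<^sup>2)\<close> and \<open>H\<^sup>\<eta>(S\<^sup>2)\<close> occur below as a carrier \<open>S\<close>, closed under
  subtraction, together with a (semi)norm \<open>nrm\<close>; elements of \<open>L\<^sup>2(S\<^sup>2)\<close> are functions that are not
  identified when they agree almost everywhere. The following is the Borel sigma-algebra of the
  topology induced by \<open>nrm\<close> on \<open>S\<close>.
\<close>

definition norm_borel :: "'b::minus set \<Rightarrow> ('b \<Rightarrow> real) \<Rightarrow> 'b measure" where
  "norm_borel S nrm =
     sigma S {U. U \<subseteq> S \<and> (\<forall>f\<in>U. \<exists>r>0. \<forall>g\<in>S. nrm (g - f) < r \<longrightarrow> g \<in> U)}"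

definition L2_rv :: "'w measure \<Rightarrow> 'b::minus set \<Rightarrow> ('b \<Rightarrow> real) \<Rightarrow> ('w \<Rightarrow> 'b) \<Rightarrow> bool" where
  "L2_rv M S nrm Z \<longleftrightarrow>
     Z \<in> measurable M (norm_borel S nrm) \<and> integrable M (\<lambda>\<omega>. (nrm (Z \<omega>))\<^sup>2)"

definition L2_norm :: "'w measure \<Rightarrow> ('b \<Rightarrow> real) \<Rightarrow> ('w \<Rightarrow> 'b) \<Rightarrow> real" where
  "L2_norm M nrm Z = sqrt (\<integral>\<omega>. (nrm (Z \<omega>))\<^sup>2 \<partial>M)"


section \<open>The unit sphere\<close>

text \<open>Surface measure \<open>d\<sigma> = sin \<theta> d\<theta> d\<phi>\<close>, with colatitude \<open>\<theta>\<close> and longitude \<open>\<phi>\<close>.\<close>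

definition sphere_measure :: "(real^3) measure" where
  "sphere_measure =
     distr
       (density (lborel :: (real \<times> real) measure)
          (\<lambda>(\<theta>, \<phi>). ennreal (sin \<theta>) * indicator ({0..pi} \<times> {0..<2 * pi}) (\<theta>, \<phi>)))
       (restrict_space borel (sphere 0 1))
       (\<lambda>(\<theta>, \<phi>). vector [sin \<theta> * cos \<phi>, sin \<theta> * sin \<phi>, cos \<theta>])"

definition L2_sphere :: "(real^3 \<Rightarrow> real) set" where
  "L2_sphere = {f. f \<in> borel_measurable sphere_measure \<and> integrable sphere_measure (\<lambda>x. (f x)\<^sup>2)}"

definition sphere_inner :: "(real^3 \<Rightarrow> real) \<Rightarrow> (real^3 \<Rightarrow> real) \<Rightarrow> real" where
  "sphere_inner f g = (\<integral>x. f x * g x \<partial>sphere_measure)"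

definition sphere_norm :: "(real^3 \<Rightarrow> real) \<Rightarrow> real" where
  "sphere_norm f = sqrt (sphere_inner f f)"

definition partial_deriv :: "'n::finite \<Rightarrow> (real^'n \<Rightarrow> real) \<Rightarrow> real^'n \<Rightarrow> real" where
  "partial_deriv i f x = deriv (\<lambda>h. f (x + h *\<^sub>R axis i 1)) 0"

definition C2_on :: "(real^'n::finite) set \<Rightarrow> (real^'n \<Rightarrow> real) \<Rightarrow> bool" where
  "C2_on U f \<longleftrightarrow>
     (\<forall>x\<in>U. f differentiable at x) \<and>
     (\<forall>i. \<forall>x\<in>U. partial_deriv i f differentiable at x) \<and>
     (\<forall>i j. continuous_on U (partial_deriv j (partial_deriv i f)))"

text \<open>
  For a function \<open>f\<close> on the sphere, the Laplace--Beltrami operator is the Euclidean Laplacian of the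
  extension of \<open>f\<close> that is constant along rays, evaluated on the sphere.
\<close>

definition radial_ext :: "(real^3 \<Rightarrow> real) \<Rightarrow> real^3 \<Rightarrow> real" where
  "radial_ext f y = f (y /\<^sub>R norm y)"

definition laplace_beltrami :: "(real^3 \<Rightarrow> real) \<Rightarrow> real^3 \<Rightarrow> real" where
  "laplace_beltrami f x = (\<Sum>i\<in>UNIV. partial_deriv i (partial_deriv i (radial_ext f)) x)"

definition sh_eigenvalue :: "nat \<Rightarrow> real" where
  "sh_eigenvalue l = real l * (real l + 1)"

definition sh_index :: "(nat \<times> int) set" where
  "sh_index = {(l, m). \<bar>m\<bar> \<le> int l}"

text \<open>
  Real spherical harmonics are only determined up to conventions (phase, order within a degree), so
  they are described by their defining properties: an orthonormal basis of \<open>L\<^sup>2(S\<^sup>2)\<close>, indexed by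
  degree and order, of eigenfunctions of the Laplace--Beltrami operator. \<open>Y l m\<close> is relevant only
  for \<open>(l, m) \<in> sh_index\<close>.
\<close>

definition real_spherical_harmonics :: "(nat \<Rightarrow> int \<Rightarrow> real^3 \<Rightarrow> real) \<Rightarrow> bool" where
  "real_spherical_harmonics Y \<longleftrightarrow>
     (\<forall>(l, m)\<in>sh_index.
        C2_on (- {0}) (radial_ext (Y l m)) \<and>
        (\<forall>x\<in>sphere 0 1. laplace_beltrami (Y l m) x = - sh_eigenvalue l * Y l m x) \<and>
        Y l m \<in> L2_sphere) \<and>
     (\<forall>(l, m)\<in>sh_index. \<forall>(l', m')\<in>sh_index.
        sphere_inner (Y l m) (Y l' m') = (if l = l' \<and> m = m' then 1 else 0)) \<and>
     (\<forall>f\<in>L2_sphere.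
        (\<lambda>n. sphere_norm (\<lambda>x. f x - (\<Sum>l\<le>n. \<Sum>m=-int l..int l. sphere_inner f (Y l m) * Y l m x)))
          \<longlonglongrightarrow> 0)"

text \<open>
  An element of \<open>H\<^sup>\<eta>(S\<^sup>2)\<close>, a distribution if \<open>\<eta> < 0\<close>, is represented by the family of its
  coefficients with respect to the spherical harmonics, set to zero outside \<open>sh_index\<close>.
\<close>

definition sobolev_weight :: "real \<Rightarrow> nat \<Rightarrow> real" where
  "sobolev_weight \<eta> l = (1 + sh_eigenvalue l) powr \<eta>"

definition sobolev_space :: "real \<Rightarrow> (nat \<Rightarrow> int \<Rightarrow> real) set" where
  "sobolev_space \<eta> =
     {f. (\<forall>l m. (l, m) \<notin> sh_index \<longrightarrow> f l m = 0) \<and>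
         (\<lambda>(l, m). sobolev_weight \<eta> l * (f l m)\<^sup>2) summable_on sh_index}"

definition sobolev_norm :: "real \<Rightarrow> (nat \<Rightarrow> int \<Rightarrow> real) \<Rightarrow> real" where
  "sobolev_norm \<eta> f = sqrt (\<Sum>\<^sub>\<infinity>(l, m)\<in>sh_index. sobolev_weight \<eta> l * (f l m)\<^sup>2)"


section \<open>Stochastic processes\<close>

definition complete_filtered_prob_space ::
  "'w measure \<Rightarrow> real \<Rightarrow> (real \<Rightarrow> 'w measure) \<Rightarrow> bool" where
  "complete_filtered_prob_space M T F \<longleftrightarrow>
     prob_space M \<and>
     (\<forall>t\<in>{0..T}. subalgebra M (F t)) \<and>
     (\<forall>s\<in>{0..T}. \<forall>t\<in>{0..T}. s \<le> t \<longrightarrow> sets (F s) \<subseteq> sets (F t)) \<and>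
     (\<forall>N\<in>null_sets M. \<forall>A. A \<subseteq> N \<longrightarrow> A \<in> sets (F 0))"

text \<open>
  Levy processes on \<open>[0, \<infinity>)\<close> with values in \<open>S\<close>: \<open>Z 0 = 0\<close>, independent increments, stationary
  increments, stochastic continuity, cadlag paths.
\<close>

definition levy_process ::
  "'w measure \<Rightarrow> 'b::minus set \<Rightarrow> ('b \<Rightarrow> real) \<Rightarrow> (real \<Rightarrow> 'w \<Rightarrow> 'b) \<Rightarrow> bool" where
  "levy_process M S nrm Z \<longleftrightarrow>
     (\<forall>t\<ge>0. Z t \<in> measurable M (norm_borel S nrm)) \<and>
     (AE \<omega> in M. nrm (Z 0 \<omega>) = 0) \<and>
     (\<forall>(s :: nat \<Rightarrow> real) n. incseq s \<and> 0 \<le> s 0 \<longrightarrow>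
        prob_space.indep_vars M (\<lambda>_. norm_borel S nrm)
          (\<lambda>i \<omega>. Z (s (Suc i)) \<omega> - Z (s i) \<omega>) {..<n}) \<and>
     (\<forall>s\<ge>0. \<forall>h\<ge>0. distr M (norm_borel S nrm) (\<lambda>\<omega>. Z (s + h) \<omega> - Z s \<omega>) =
                    distr M (norm_borel S nrm) (Z h)) \<and>
     (\<forall>t\<ge>0. \<forall>\<epsilon>>0.
        ((\<lambda>s. measure M {\<omega> \<in> space M. nrm (Z s \<omega> - Z t \<omega>) > \<epsilon>}) \<longlongrightarrow> 0) (at t within {0..})) \<and>
     (AE \<omega> in M.
        (\<forall>t\<ge>0. ((\<lambda>s. nrm (Z s \<omega> - Z t \<omega>)) \<longlongrightarrow> 0) (at_right t)) \<and>
        (\<forall>t>0. \<exists>z\<in>S. ((\<lambda>s. nrm (Z s \<omega> - z)) \<longlongrightarrow> 0) (at_left t)))"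

abbreviation real_levy_process :: "'w measure \<Rightarrow> (real \<Rightarrow> 'w \<Rightarrow> real) \<Rightarrow> bool" where
  "real_levy_process M Z \<equiv> levy_process M UNIV (\<lambda>x. \<bar>x\<bar>) Z"

text \<open>Equality of all finite-dimensional distributions.\<close>

definition identically_distributed ::
  "'w measure \<Rightarrow> (real \<Rightarrow> 'w \<Rightarrow> real) \<Rightarrow> (real \<Rightarrow> 'w \<Rightarrow> real) \<Rightarrow> bool" where
  "identically_distributed M Z W \<longleftrightarrow>
     (\<forall>J. finite J \<and> J \<subseteq> {0..} \<longrightarrow>
        distr M (PiM J (\<lambda>_. borel)) (\<lambda>\<omega>. \<lambda>t\<in>J. Z t \<omega>) =
        distr M (PiM J (\<lambda>_. borel)) (\<lambda>\<omega>. \<lambda>t\<in>J. W t \<omega>))"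

definition rv_indep_of_process ::
  "'w measure \<Rightarrow> 'a measure \<Rightarrow> ('w \<Rightarrow> 'a) \<Rightarrow> 'b measure \<Rightarrow> (real \<Rightarrow> 'w \<Rightarrow> 'b) \<Rightarrow> bool" where
  "rv_indep_of_process M A V B Z \<longleftrightarrow>
     prob_space.indep_set M
       (sets (vimage_algebra (space M) V A))
       (sets (vimage_algebra (space M) (\<lambda>\<omega>. \<lambda>t\<in>{0..}. Z t \<omega>) (PiM {0..} (\<lambda>_. B))))"

text \<open>
  Stochastic integral \<open>J = \<integral>\<^sub>0\<^sup>t f(s) dZ(s)\<close> of a deterministic square-integrable function against a
  real-valued square-integrable Levy process: the \<open>L\<^sup>2(\<Omega>)\<close>-limit of the integrals of step functions
  converging to \<open>f\<close> in \<open>L\<^sup>2([0,t])\<close>. It determines \<open>J\<close> up to almost sure equality. The process need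
  not be centred, as the step integrals of the drift converge to \<open>E[Z(1)] \<integral>\<^sub>0\<^sup>t f(s) ds\<close>.
\<close>

definition step_fun :: "nat \<Rightarrow> (nat \<Rightarrow> real) \<Rightarrow> (nat \<Rightarrow> real) \<Rightarrow> real \<Rightarrow> real" where
  "step_fun n s c u = (\<Sum>i<n. c i * indicator {s i<..s (Suc i)} u)"

definition step_integral ::
  "(real \<Rightarrow> 'w \<Rightarrow> real) \<Rightarrow> nat \<Rightarrow> (nat \<Rightarrow> real) \<Rightarrow> (nat \<Rightarrow> real) \<Rightarrow> 'w \<Rightarrow> real" where
  "step_integral Z n s c \<omega> = (\<Sum>i<n. c i * (Z (s (Suc i)) \<omega> - Z (s i) \<omega>))"

definition has_stoch_integral ::
  "'w measure \<Rightarrow> (real \<Rightarrow> 'w \<Rightarrow> real) \<Rightarrow> real \<Rightarrow> (real \<Rightarrow> real) \<Rightarrow> ('w \<Rightarrow> real) \<Rightarrow> bool" where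
  "has_stoch_integral M Z t f J \<longleftrightarrow>
     J \<in> borel_measurable M \<and> integrable M (\<lambda>\<omega>. (J \<omega>)\<^sup>2) \<and>
     (\<exists>n s c.
        (\<forall>k. (\<forall>i<n k. s k i \<le> s k (Suc i)) \<and> 0 \<le> s k 0 \<and> s k (n k) \<le> t) \<and>
        (\<lambda>k. \<integral>\<^sup>+u\<in>{0..t}. ennreal ((f u - step_fun (n k) (s k) (c k) u)\<^sup>2) \<partial>lborel) \<longlonglongrightarrow> 0 \<and>
        (\<lambda>k. \<integral>\<^sup>+\<omega>. ennreal ((J \<omega> - step_integral Z (n k) (s k) (c k) \<omega>)\<^sup>2) \<partial>M) \<longlonglongrightarrow> 0)"


section \<open>Spectral approximation of the mild solution\<close>

text \<open>
  \<open>J l m t\<close> stands for the stochastic convolution of the \<open>(l, m)\<close>-th component of the noise.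
\<close>

definition spectral_approx ::
  "(nat \<Rightarrow> int \<Rightarrow> real^3 \<Rightarrow> real) \<Rightarrow> ('w \<Rightarrow> real^3 \<Rightarrow> real) \<Rightarrow>
   (nat \<Rightarrow> int \<Rightarrow> real \<Rightarrow> 'w \<Rightarrow> real) \<Rightarrow> nat \<Rightarrow> real \<Rightarrow> 'w \<Rightarrow> real^3 \<Rightarrow> real" where
  "spectral_approx Y X0 J \<kappa> t \<omega> x =
     (\<Sum>l\<le>\<kappa>. \<Sum>m=-int l..int l.
        (exp (- sh_eigenvalue l * t) * sphere_inner (X0 \<omega>) (Y l m) + J l m t \<omega>) * Y l m x)"

end

theory Submission
  imports Defs
begin

text \<open>
  Write \<open>A n\<close> for the spectral approximation of the solution \<open>X t\<close> of level \<open>n\<close>. For \<open>n \<ge> \<kappa>\<close> the error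
  splits as \<open>X t - A \<kappa> = (X t - A n) + (A n - A \<kappa>)\<close>. The first part vanishes in \<open>L\<^sup>2(\<Omega>; L\<^sup>2(S\<^sup>2))\<close> as
  \<open>n \<rightarrow> \<infinity>\<close>, because the series defines \<open>X t\<close>; so a bound for the second part that is uniform in \<open>n\<close>
  suffices, and only finite sums of harmonics ever occur. The functions \<open>Y l m\<close> are orthonormal, so
  the norm of the second part is the Euclidean norm of its coefficients of degrees \<open>\<kappa> < l \<le> n\<close>, and the
  contributions of \<open>X0\<close> and of the noise separate by Minkowski's inequality (\<open>spectral_error_le\<close>).
  Only second moments of single components survive; their correlations never enter.

  The contribution of \<open>X0\<close> is at most \<open>exp (- (\<kappa> + 1)\<^sup>2 t)\<close> times its norm, by Bessel's inequality and
  \<open>l (l + 1) \<ge> (\<kappa> + 1)\<^sup>2\<close> for \<open>l > \<kappa>\<close>. For the noise, the second moment of a stochastic convolution is controlled by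
  an inequality version of Ito's isometry for square-integrable Levy processes that need not be
  centred: \<open>E[(\<integral> f dZ)\<^sup>2] \<le> (Var Z 1 + t (E Z 1)\<^sup>2) \<integral> f\<^sup>2\<close> on \<open>[0, t]\<close> (\<open>stoch_integral_l2norm_le\<close>).
  It holds for step functions because the increments are independent with mean and variance
  proportional to their length, and extends to \<open>f\<close> by \<open>L\<^sup>2\<close>-approximation. With
  \<open>\<integral> exp (- 2 \<lambda> (t - s)) ds \<le> 1 / (2 \<lambda>)\<close> for \<open>\<lambda> = l (l + 1)\<close>, each coefficient of the noise of degree \<open>l\<close> contributes at
  most \<open>(v l m + T (mu l m)\<^sup>2) / (2 l (l + 1))\<close>.

  What remains is to show that the sum of these numbers over \<open>l > \<kappa>\<close> is of order \<open>\<kappa> powr (- 2 \<beta>)\<close>. Under the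
  Sobolev assumption the factor \<open>1 / (l (l + 1))\<close> is \<open>(1 + l (l + 1)) powr \<eta>\<close>, which makes the sum
  finite, times \<open>(1 + l (l + 1)) powr - (\<eta> + 1)\<close> up to a constant, and the latter is at most
  \<open>\<kappa> powr (- 2 (\<eta> + 1))\<close> (\<open>tail_sum_Sobolev\<close>). Under decay of the angular power spectrum the \<open>2 l + 1\<close>
  orders of degree \<open>l\<close> together contribute a multiple of \<open>l powr (- \<alpha> - 1)\<close>, whose tail sums are of order
  \<open>\<kappa> powr - \<alpha>\<close> (\<open>tail_sum_powr\<close>).
\<close>

section \<open>Square-integrable functions\<close>

definition square_integrable :: "'a measure \<Rightarrow> ('a \<Rightarrow> real) \<Rightarrow> bool" where
  "square_integrable N f \<longleftrightarrow> f \<in> borel_measurable N \<and> integrable N (\<lambda>x. (f x)\<^sup>2)"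

definition l2norm :: "'a measure \<Rightarrow> ('a \<Rightarrow> real) \<Rightarrow> real" where
  "l2norm N f = sqrt (\<integral>x. (f x)\<^sup>2 \<partial>N)"

lemma l2norm_nonneg [simp]: "0 \<le> l2norm N f"
  by (simp add: l2norm_def)

lemma l2norm_sq: "(l2norm N f)\<^sup>2 = (\<integral>x. (f x)\<^sup>2 \<partial>N)"
  by (simp add: l2norm_def)

lemma square_integrable_mult:
  assumes "square_integrable N f" "square_integrable N g"
  shows "integrable N (\<lambda>x. f x * g x)"
proof (rule Bochner_Integration.integrable_bound)
  show "integrable N (\<lambda>x. (f x)\<^sup>2 + (g x)\<^sup>2)"
    using assms by (simp add: square_integrable_def)
  show "(\<lambda>x. f x * g x) \<in> borel_measurable N"
    using assms by (auto simp: square_integrable_def)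
  have "\<bar>a * b\<bar> \<le> a\<^sup>2 + b\<^sup>2" for a b :: real
  proof -
    have "2 * \<bar>a\<bar> * \<bar>b\<bar> \<le> a\<^sup>2 + b\<^sup>2" using sum_squares_bound[of "\<bar>a\<bar>" "\<bar>b\<bar>"] by simp
    moreover have "0 \<le> \<bar>a\<bar> * \<bar>b\<bar>" by simp
    ultimately show ?thesis unfolding abs_mult by linarith
  qed
  then show "AE x in N. norm (f x * g x) \<le> norm ((f x)\<^sup>2 + (g x)\<^sup>2)"
    by auto
qed

lemma square_integrable_zero [simp]: "square_integrable N (\<lambda>x. 0)"
  by (simp add: square_integrable_def)

lemma square_integrable_cmult:
  "square_integrable N f \<Longrightarrow> square_integrable N (\<lambda>x. c * f x)"
  by (auto simp: square_integrable_def power_mult_distrib)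

lemma square_integrable_add:
  assumes "square_integrable N f" "square_integrable N g"
  shows "square_integrable N (\<lambda>x. f x + g x)"
proof -
  have "integrable N (\<lambda>x. (f x)\<^sup>2 + (g x)\<^sup>2 + 2 * (f x * g x))"
    using assms square_integrable_mult[OF assms] by (simp add: square_integrable_def)
  then show ?thesis
    using assms by (auto simp: square_integrable_def power2_sum mult.assoc)
qed

lemma square_integrable_diff:
  assumes "square_integrable N f" "square_integrable N g"
  shows "square_integrable N (\<lambda>x. f x - g x)"
  using square_integrable_add[OF assms(1) square_integrable_cmult[OF assms(2), of "-1"]] by simp

lemma square_integrable_sum:
  "finite I \<Longrightarrow> (\<And>i. i \<in> I \<Longrightarrow> square_integrable N (f i)) \<Longrightarrow>
   square_integrable N (\<lambda>x. \<Sum>i\<in>I. f i x)"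
  by (induction rule: finite_induct) (auto intro: square_integrable_add)

lemma square_integrable_bound:
  assumes "square_integrable N g" "f \<in> borel_measurable N"
    and "\<And>x. x \<in> space N \<Longrightarrow> \<bar>f x\<bar> \<le> g x"
  shows "square_integrable N f"
proof -
  have "integrable N (\<lambda>x. (f x)\<^sup>2)"
  proof (rule Bochner_Integration.integrable_bound)
    show "integrable N (\<lambda>x. (g x)\<^sup>2)" using assms by (simp add: square_integrable_def)
    show "(\<lambda>x. (f x)\<^sup>2) \<in> borel_measurable N" using assms by measurable
    show "AE x in N. norm ((f x)\<^sup>2) \<le> norm ((g x)\<^sup>2)"
    proof (rule AE_I2)
      fix x assume "x \<in> space N"
      from power_mono[OF assms(3)[OF this], of 2] show "norm ((f x)\<^sup>2) \<le> norm ((g x)\<^sup>2)"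
        by simp
    qed
  qed
  then show ?thesis using assms by (simp add: square_integrable_def)
qed

lemma l2norm_cmult: "l2norm N (\<lambda>x. c * f x) = \<bar>c\<bar> * l2norm N f"
  by (simp add: l2norm_def power_mult_distrib real_sqrt_mult)

text \<open>The quadratic polynomial \<open>r \<mapsto> \<parallel>f - r g\<parallel>\<^sup>2\<close> is nonnegative, so its discriminant is not positive.\<close>
lemma integral_Cauchy_Schwarz:
  assumes f: "square_integrable N f" and g: "square_integrable N g"
  shows "\<bar>\<integral>x. f x * g x \<partial>N\<bar> \<le> l2norm N f * l2norm N g"
proof -
  define A B I where "A = (\<integral>x. (f x)\<^sup>2 \<partial>N)" and "B = (\<integral>x. (g x)\<^sup>2 \<partial>N)"
    and "I = (\<integral>x. f x * g x \<partial>N)"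
  have quad: "0 \<le> A - 2 * r * I + r\<^sup>2 * B" for r
  proof -
    have "0 \<le> (\<integral>x. (f x - r * g x)\<^sup>2 \<partial>N)" by simp
    also have "\<dots> = (\<integral>x. (f x)\<^sup>2 - 2 * r * (f x * g x) + r\<^sup>2 * (g x)\<^sup>2 \<partial>N)"
      by (intro Bochner_Integration.integral_cong) (auto simp: power2_eq_square algebra_simps)
    also have "\<dots> = A - 2 * r * I + r\<^sup>2 * B"
      using f g square_integrable_mult[OF f g]
      by (simp add: A_def B_def I_def square_integrable_def)
    finally show ?thesis .
  qed
  have B0: "0 \<le> B" by (simp add: B_def)
  have "I\<^sup>2 \<le> A * B"
  proof (cases "B = 0")
    case True
    have "I = 0"
    proof (rule ccontr)
      assume "I \<noteq> 0"
      then show False using quad[of "(A + 1) / (2 * I)"] True by (simp add: field_simps)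
    qed
    then show ?thesis using True by simp
  next
    case False
    then show ?thesis using quad[of "I / B"] B0
      by (simp add: power2_eq_square field_simps)
  qed
  then have "sqrt (I\<^sup>2) \<le> sqrt (A * B)" by (rule real_sqrt_le_mono)
  then show ?thesis by (simp add: l2norm_def A_def B_def I_def real_sqrt_mult)
qed

lemma l2norm_triangle:
  assumes f: "square_integrable N f" and g: "square_integrable N g"
  shows "l2norm N (\<lambda>x. f x + g x) \<le> l2norm N f + l2norm N g"
proof (rule power2_le_imp_le)
  have "(l2norm N (\<lambda>x. f x + g x))\<^sup>2 = (\<integral>x. (f x)\<^sup>2 + (g x)\<^sup>2 + 2 * (f x * g x) \<partial>N)"
    unfolding l2norm_sq by (simp add: power2_sum mult.assoc)
  also have "\<dots> = (l2norm N f)\<^sup>2 + (l2norm N g)\<^sup>2 + 2 * (\<integral>x. f x * g x \<partial>N)"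
    using f g square_integrable_mult[OF f g] by (simp add: l2norm_sq square_integrable_def)
  also have "\<dots> \<le> (l2norm N f + l2norm N g)\<^sup>2"
    using integral_Cauchy_Schwarz[OF f g] by (simp add: power2_sum)
  finally show "(l2norm N (\<lambda>x. f x + g x))\<^sup>2 \<le> (l2norm N f + l2norm N g)\<^sup>2" .
qed simp

text \<open>This includes non-integrable \<open>f\<^sup>2\<close>, whose Bochner integral is \<open>0\<close> by convention.\<close>
lemma l2norm_mono:
  assumes "square_integrable N g" "\<And>x. x \<in> space N \<Longrightarrow> \<bar>f x\<bar> \<le> g x"
  shows "l2norm N f \<le> l2norm N g"
  unfolding l2norm_def
proof (intro real_sqrt_le_mono integral_mono')
  show "(f x)\<^sup>2 \<le> (g x)\<^sup>2" if "x \<in> space N" for x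
    using power_mono[OF assms(2)[OF that], of 2] by simp
qed (use assms in \<open>auto simp: square_integrable_def\<close>)

lemma l2norm_le_sum:
  assumes "square_integrable N g" "square_integrable N h"
    and "\<And>x. x \<in> space N \<Longrightarrow> \<bar>f x\<bar> \<le> g x + h x"
  shows "l2norm N f \<le> l2norm N g + l2norm N h"
  using l2norm_mono[OF square_integrable_add[OF assms(1,2)] assms(3)]
    l2norm_triangle[OF assms(1,2)] by linarith

lemma l2norm_diff_bound:
  assumes "square_integrable N f" "square_integrable N g"
  shows "\<bar>l2norm N f - l2norm N g\<bar> \<le> l2norm N (\<lambda>x. f x - g x)"
proof -
  have "l2norm N f \<le> l2norm N g + l2norm N (\<lambda>x. f x - g x)"
    using l2norm_triangle[OF assms(2) square_integrable_diff[OF assms]] by simp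
  moreover have "l2norm N g \<le> l2norm N f + l2norm N (\<lambda>x. g x - f x)"
    using l2norm_triangle[OF assms(1) square_integrable_diff[OF assms(2,1)]] by simp
  moreover have "l2norm N (\<lambda>x. g x - f x) = l2norm N (\<lambda>x. f x - g x)"
    by (simp add: l2norm_def power2_commute)
  ultimately show ?thesis by linarith
qed

section \<open>Finite orthonormal systems\<close>

text \<open>
  The square of the distance from \<open>f\<close> to an arbitrary linear combination is kept in this expanded
  form since it serves three purposes: \<open>f = 0\<close> gives Pythagoras, the Fourier coefficients of \<open>f\<close>
  give Bessel's inequality, and for random \<open>f\<close> and \<open>c\<close> the right-hand side is visibly measurable.
\<close>
lemma l2norm_diff_orthonormal_sq:
  assumes I: "finite I" and f: "square_integrable N f"
    and e: "\<And>i. i \<in> I \<Longrightarrow> square_integrable N (e i)"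
    and orth: "\<And>i j. i \<in> I \<Longrightarrow> j \<in> I \<Longrightarrow> (\<integral>x. e i x * e j x \<partial>N) = (if i = j then 1 else 0)"
  shows "(l2norm N (\<lambda>x. f x - (\<Sum>i\<in>I. c i * e i x)))\<^sup>2 =
    (l2norm N f)\<^sup>2 - 2 * (\<Sum>i\<in>I. c i * (\<integral>x. f x * e i x \<partial>N)) + (\<Sum>i\<in>I. (c i)\<^sup>2)"
proof -
  have int_fe: "integrable N (\<lambda>x. f x * e i x)" if "i \<in> I" for i
    by (rule square_integrable_mult[OF f e[OF that]])
  have int_ee: "integrable N (\<lambda>x. e i x * e j x)" if "i \<in> I" "j \<in> I" for i j
    by (rule square_integrable_mult[OF e[OF that(1)] e[OF that(2)]])
  have "(l2norm N (\<lambda>x. f x - (\<Sum>i\<in>I. c i * e i x)))\<^sup>2 =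
     (\<integral>x. (f x)\<^sup>2 - 2 * (\<Sum>i\<in>I. c i * (f x * e i x))
        + (\<Sum>i\<in>I. \<Sum>j\<in>I. c i * c j * (e i x * e j x)) \<partial>N)"
    unfolding l2norm_sq
  proof (rule Bochner_Integration.integral_cong[OF refl])
    fix x
    have "(\<Sum>i\<in>I. c i * e i x)\<^sup>2 = (\<Sum>i\<in>I. \<Sum>j\<in>I. c i * c j * (e i x * e j x))"
      by (simp add: power2_eq_square sum_product mult_ac)
    moreover have "f x * (\<Sum>i\<in>I. c i * e i x) = (\<Sum>i\<in>I. c i * (f x * e i x))"
      by (simp add: sum_distrib_left mult_ac)
    ultimately show "(f x - (\<Sum>i\<in>I. c i * e i x))\<^sup>2 =
        (f x)\<^sup>2 - 2 * (\<Sum>i\<in>I. c i * (f x * e i x))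
        + (\<Sum>i\<in>I. \<Sum>j\<in>I. c i * c j * (e i x * e j x))"
      by (simp add: power2_diff algebra_simps)
  qed
  also have "\<dots> = (l2norm N f)\<^sup>2 - 2 * (\<Sum>i\<in>I. c i * (\<integral>x. f x * e i x \<partial>N))
      + (\<Sum>i\<in>I. \<Sum>j\<in>I. c i * c j * (\<integral>x. e i x * e j x \<partial>N))"
    using f int_fe int_ee by (simp add: l2norm_sq square_integrable_def)
  also have "(\<Sum>i\<in>I. \<Sum>j\<in>I. c i * c j * (\<integral>x. e i x * e j x \<partial>N)) = (\<Sum>i\<in>I. (c i)\<^sup>2)"
  proof (rule sum.cong[OF refl])
    fix i assume i: "i \<in> I"
    have "(\<Sum>j\<in>I. c i * c j * (\<integral>x. e i x * e j x \<partial>N)) = (\<Sum>j\<in>I. if i = j then c i * c j else 0)"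
      using i by (intro sum.cong) (auto simp: orth)
    also have "\<dots> = (c i)\<^sup>2" using i I by (simp add: power2_eq_square)
    finally show "(\<Sum>j\<in>I. c i * c j * (\<integral>x. e i x * e j x \<partial>N)) = (c i)\<^sup>2" .
  qed
  finally show ?thesis .
qed

lemma l2norm_orthonormal_sum:
  assumes "finite I" "\<And>i. i \<in> I \<Longrightarrow> square_integrable N (e i)"
    and "\<And>i j. i \<in> I \<Longrightarrow> j \<in> I \<Longrightarrow> (\<integral>x. e i x * e j x \<partial>N) = (if i = j then 1 else 0)"
  shows "l2norm N (\<lambda>x. \<Sum>i\<in>I. c i * e i x) = L2_set c I"
proof -
  have "(l2norm N (\<lambda>x. \<Sum>i\<in>I. c i * e i x))\<^sup>2 = (L2_set c I)\<^sup>2"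
    using l2norm_diff_orthonormal_sq[of I N "\<lambda>x. 0" e c] assms
    by (simp add: l2norm_sq L2_set_def sum_nonneg)
  then show ?thesis by simp
qed

lemma Bessel_inequality:
  assumes "finite I" "square_integrable N f" "\<And>i. i \<in> I \<Longrightarrow> square_integrable N (e i)"
    and "\<And>i j. i \<in> I \<Longrightarrow> j \<in> I \<Longrightarrow> (\<integral>x. e i x * e j x \<partial>N) = (if i = j then 1 else 0)"
  shows "L2_set (\<lambda>i. \<integral>x. f x * e i x \<partial>N) I \<le> l2norm N f"
proof (rule power2_le_imp_le)
  have "0 \<le> (l2norm N f)\<^sup>2 - (\<Sum>i\<in>I. (\<integral>x. f x * e i x \<partial>N)\<^sup>2)"
    using l2norm_diff_orthonormal_sq[of I N f e "\<lambda>i. \<integral>x. f x * e i x \<partial>N"] assms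
    by (smt (verit, best) power2_eq_square sum.cong zero_le_power2)
  then show "(L2_set (\<lambda>i. \<integral>x. f x * e i x \<partial>N) I)\<^sup>2 \<le> (l2norm N f)\<^sup>2"
    by (simp add: L2_set_def sum_nonneg)
qed simp

section \<open>Measurability of seminormed random elements\<close>

text \<open>Lipschitz functionals are continuous for the (semi)norm, hence Borel.\<close>
lemma Lipschitz_measurable_norm_borel:
  fixes \<phi> :: "'b::minus \<Rightarrow> real"
  assumes K: "0 \<le> K"
    and nonneg: "\<And>f g. f \<in> S \<Longrightarrow> g \<in> S \<Longrightarrow> 0 \<le> nrm (g - f)"
    and Lipschitz: "\<And>f g. f \<in> S \<Longrightarrow> g \<in> S \<Longrightarrow> \<bar>\<phi> g - \<phi> f\<bar> \<le> K * nrm (g - f)"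
  shows "\<phi> \<in> borel_measurable (norm_borel S nrm)"
proof (rule borel_measurableI)
  fix U :: "real set" assume U: "open U"
  let ?G = "{U. U \<subseteq> S \<and> (\<forall>f\<in>U. \<exists>r>0. \<forall>g\<in>S. nrm (g - f) < r \<longrightarrow> g \<in> U)}"
  have sp: "space (norm_borel S nrm) = S"
    unfolding norm_borel_def by (intro space_measure_of) auto
  have "\<phi> -` U \<inter> S \<in> ?G"
  proof (intro CollectI conjI ballI)
    fix f assume f: "f \<in> \<phi> -` U \<inter> S"
    then obtain d where d: "d > 0" "\<And>y. dist y (\<phi> f) < d \<Longrightarrow> y \<in> U"
      using U unfolding open_dist by auto
    show "\<exists>r>0. \<forall>g\<in>S. nrm (g - f) < r \<longrightarrow> g \<in> \<phi> -` U \<inter> S"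
    proof (intro exI[of _ "d / (K + 1)"] conjI ballI impI)
      fix g assume g: "g \<in> S" "nrm (g - f) < d / (K + 1)"
      have "\<bar>\<phi> g - \<phi> f\<bar> \<le> K * nrm (g - f)" using Lipschitz f g by auto
      also have "\<dots> \<le> (K + 1) * nrm (g - f)" using nonneg f g by (intro mult_right_mono) auto
      also have "\<dots> < d" using g(2) K by (simp add: field_simps)
      finally show "g \<in> \<phi> -` U \<inter> S" using d(2) g by (auto simp: dist_real_def)
    qed (use d K in auto)
  qed auto
  then show "\<phi> -` U \<inter> space (norm_borel S nrm) \<in> sets (norm_borel S nrm)"
    unfolding sp by (simp add: norm_borel_def sets_measure_of) (auto simp: norm_borel_def)
qed

lemma norm_borel_real: "norm_borel UNIV (\<lambda>x::real. \<bar>x\<bar>) = borel"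
  unfolding norm_borel_def borel_def
  by (rule arg_cong[where f = "sigma UNIV"]) (auto simp: open_dist dist_real_def)

section \<open>Moments of square-integrable Levy processes\<close>

text \<open>Multiples \<open>n * t\<close> differ from a multiple of \<open>1 / k\<close>, on which \<open>f\<close> is linear, by less than
  \<open>1 / k\<close>; so \<open>n * (f t - t * f 1)\<close> stays bounded as \<open>n\<close> grows.\<close>
lemma additive_locally_bounded_imp_linear:
  fixes f :: "real \<Rightarrow> real"
  assumes add: "\<And>s h. 0 \<le> s \<Longrightarrow> 0 \<le> h \<Longrightarrow> f (s + h) = f s + f h"
    and d: "0 < d" and bound: "\<And>h. 0 \<le> h \<Longrightarrow> h \<le> d \<Longrightarrow> \<bar>f h\<bar> \<le> K"
    and t: "0 \<le> t"
  shows "f t = t * f 1"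
proof -
  define g where "g x = f x - x * f 1" for x
  have gadd: "g (s + h) = g s + g h" if "0 \<le> s" "0 \<le> h" for s h
    using add[OF that] by (simp add: g_def algebra_simps)
  have gmult: "g (real n * s) = real n * g s" if "0 \<le> s" for n s
  proof (induction n)
    case 0
    show ?case using gadd[of 0 0] by simp
  next
    case (Suc n)
    have "g (real (Suc n) * s) = g (real n * s + s)" by (simp add: algebra_simps)
    also have "\<dots> = real (Suc n) * g s" using Suc that by (simp add: gadd algebra_simps)
    finally show ?case .
  qed
  obtain k :: nat where k: "k > 0" "1 / real k < d"
    using d by (metis nat_approx_posE zero_less_Suc)
  have "g (1 / real k) = 0"
    using gmult[of "1 / real k" k] k by (simp add: g_def)
  then have g0: "g (real i / real k) = 0" for i
    using gmult[of "1 / real k" i] by simp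
  have gbound: "\<bar>g x\<bar> \<le> K + d * \<bar>f 1\<bar>" if x: "0 \<le> x" for x
  proof -
    define i where "i = nat \<lfloor>x * real k\<rfloor>"
    define r where "r = x - real i / real k"
    have "real i \<le> x * real k" "x * real k < real i + 1"
      using x unfolding i_def by (auto simp: le_floor_iff intro: floor_correct)
    then have "real i / real k \<le> x" "x \<le> (real i + 1) / real k"
      using k by (auto simp: pos_divide_le_eq pos_le_divide_eq)
    then have r: "0 \<le> r" "r \<le> 1 / real k"
      by (auto simp: r_def add_divide_distrib)
    have "g x = g (real i / real k + r)" by (simp add: r_def)
    also have "\<dots> = g r" using r g0 by (simp add: gadd)
    finally have "\<bar>g x\<bar> \<le> \<bar>f r\<bar> + \<bar>r * f 1\<bar>" by (simp add: g_def)
    moreover have "\<bar>f r\<bar> \<le> K" using bound r k by auto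
    moreover have "\<bar>r * f 1\<bar> \<le> d * \<bar>f 1\<bar>"
      using r k by (auto simp: abs_mult intro!: mult_right_mono)
    ultimately show ?thesis by linarith
  qed
  have "g t = 0"
  proof (rule ccontr)
    assume "g t \<noteq> 0"
    then obtain n :: nat where "K + d * \<bar>f 1\<bar> < real n * \<bar>g t\<bar>"
      using reals_Archimedean3[of "\<bar>g t\<bar>"] by auto
    moreover have "real n * \<bar>g t\<bar> = \<bar>g (real n * t)\<bar>" using gmult[OF t] by (simp add: abs_mult)
    ultimately show False using gbound[of "real n * t"] t by simp
  qed
  then show ?thesis by (simp add: g_def)
qed

context prob_space
begin

text \<open>Mixed moments of centred independent variables vanish.\<close>
lemma expectation_square_sum_indep:
  fixes D :: "nat \<Rightarrow> 'a \<Rightarrow> real"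
  assumes ind: "indep_vars (\<lambda>_. borel) D {..<n}"
    and sq: "\<And>i. i < n \<Longrightarrow> square_integrable M (D i)"
    and cent: "\<And>i. i < n \<Longrightarrow> expectation (D i) = 0"
  shows "expectation (\<lambda>\<omega>. (\<Sum>i<n. D i \<omega>)\<^sup>2) = (\<Sum>i<n. expectation (\<lambda>\<omega>. (D i \<omega>)\<^sup>2))"
proof -
  have mixed: "expectation (\<lambda>\<omega>. D i \<omega> * D j \<omega>) =
      (if i = j then expectation (\<lambda>\<omega>. (D i \<omega>)\<^sup>2) else 0)" if "i < n" "j < n" for i j
  proof (cases "i = j")
    case False
    have "indep_var borel (D i) borel (D j)"
      using indep_vars_sum[of "{j}" i D] indep_vars_subset[OF ind, of "{i, j}"] False that by simp
    moreover have "integrable M (D k)" if "k < n" for k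
      using sq[OF that] square_integrable_imp_integrable by (auto simp: square_integrable_def)
    ultimately show ?thesis using that False cent by (simp add: indep_var_lebesgue_integral)
  qed (simp add: power2_eq_square)
  have "expectation (\<lambda>\<omega>. (\<Sum>i<n. D i \<omega>)\<^sup>2) = (\<Sum>i<n. \<Sum>j<n. expectation (\<lambda>\<omega>. D i \<omega> * D j \<omega>))"
    unfolding power2_eq_square sum_product
    by (subst Bochner_Integration.integral_sum,
        auto intro!: sum.cong Bochner_Integration.integral_sum integrable_sum square_integrable_mult sq)
  also have "\<dots> = (\<Sum>i<n. expectation (\<lambda>\<omega>. (D i \<omega>)\<^sup>2))"
    by (intro sum.cong) (auto simp: mixed)
  finally show ?thesis .
qed

context
  fixes Z :: "real \<Rightarrow> 'a \<Rightarrow> real"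
  assumes levy: "real_levy_process M Z"
    and sq: "\<And>t. 0 \<le> t \<Longrightarrow> square_integrable M (Z t)"
begin

lemma levy_increment_distr:
  assumes "0 \<le> s" "0 \<le> h" "\<phi> \<in> borel_measurable borel"
  shows "expectation (\<lambda>\<omega>. \<phi> (Z (s + h) \<omega> - Z s \<omega>) :: real) = expectation (\<lambda>\<omega>. \<phi> (Z h \<omega>))"
proof -
  have meas [measurable]: "Z t \<in> borel_measurable M" if "0 \<le> t" for t
    using sq[OF that] by (simp add: square_integrable_def)
  have [measurable]: "Z s \<in> borel_measurable M" "Z h \<in> borel_measurable M"
      "Z (s + h) \<in> borel_measurable M"
    using assms by (auto intro: meas)
  have eq: "distr M borel (\<lambda>\<omega>. Z (s + h) \<omega> - Z s \<omega>) = distr M borel (Z h)"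
    using levy assms unfolding levy_process_def norm_borel_real by blast
  have "expectation (\<lambda>\<omega>. \<phi> (Z (s + h) \<omega> - Z s \<omega>)) =
      integral\<^sup>L (distr M borel (\<lambda>\<omega>. Z (s + h) \<omega> - Z s \<omega>)) \<phi>"
    using assms(3) by (subst integral_distr) auto
  also have "\<dots> = expectation (\<lambda>\<omega>. \<phi> (Z h \<omega>))"
    unfolding eq using assms(3) by (subst integral_distr) auto
  finally show ?thesis .
qed

lemma levy_increments_indep:
  assumes "incseq s" "0 \<le> s 0"
  shows "indep_vars (\<lambda>_. borel) (\<lambda>i \<omega>. Z (s (Suc i)) \<omega> - Z (s i) \<omega>) {..<n}"
  using levy assms unfolding levy_process_def norm_borel_real by blast

lemma levy_zero: "AE \<omega> in M. Z 0 \<omega> = 0"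
  using levy by (simp add: levy_process_def)

lemma levy_increment_square_integrable:
  "0 \<le> s \<Longrightarrow> 0 \<le> t \<Longrightarrow> square_integrable M (\<lambda>\<omega>. Z t \<omega> - Z s \<omega>)"
  by (intro square_integrable_diff sq)

lemma levy_integrable: "0 \<le> t \<Longrightarrow> integrable M (Z t)"
  using sq[of t] square_integrable_imp_integrable by (auto simp: square_integrable_def)

lemma levy_mean_additive:
  assumes "0 \<le> s" "0 \<le> h"
  shows "expectation (Z (s + h)) = expectation (Z s) + expectation (Z h)"
  using levy_increment_distr[OF assms, of "\<lambda>x. x"] assms
  by (simp add: levy_integrable)

text \<open>The increments over \<open>[0, s]\<close> and \<open>[s, s + h]\<close> are independent, and the second one is distributed
  like \<open>Z h\<close>.\<close>
lemma levy_variance_additive: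
  assumes s: "0 \<le> s" and h: "0 \<le> h"
  shows "variance (Z (s + h)) = variance (Z s) + variance (Z h)"
proof -
  define r :: "nat \<Rightarrow> real" where "r i = (if i = 0 then 0 else if i = 1 then s else s + h)" for i
  define e :: "nat \<Rightarrow> real" where "e i = (if i = 0 then expectation (Z s) else expectation (Z h))" for i
  define D where "D = (\<lambda>i \<omega>. Z (r (Suc i)) \<omega> - Z (r i) \<omega> - e i)"
  have r: "incseq r" using s h by (auto simp: r_def incseq_def)
  have r0: "0 \<le> r i" for i using s h by (simp add: r_def)
  have "indep_vars (\<lambda>_. borel) D {..<2}"
    unfolding D_def
    by (rule indep_vars_compose2[OF levy_increments_indep[OF r r0], where Y = "\<lambda>i x. x - e i"]) simp
  moreover have "square_integrable M (D i)" for i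
    unfolding D_def
    by (intro square_integrable_diff sq r0) (simp add: square_integrable_def)
  moreover have E0: "expectation (Z 0) = 0"
    using integral_cong_AE[of "Z 0" M "\<lambda>_. 0"] levy_zero levy_integrable[of 0] by simp
  then have "expectation (D i) = 0" if "i < 2" for i
  proof -
    have "i = 0 \<or> i = 1" using that by auto
    then show ?thesis
      using s h E0 by (auto simp: D_def r_def e_def levy_integrable levy_mean_additive prob_space)
  qed
  ultimately have *: "expectation (\<lambda>\<omega>. (\<Sum>i<2. D i \<omega>)\<^sup>2) = (\<Sum>i<2. expectation (\<lambda>\<omega>. (D i \<omega>)\<^sup>2))"
    by (intro expectation_square_sum_indep) auto
  have [measurable]: "Z s \<in> borel_measurable M" "Z (s + h) \<in> borel_measurable M"
      "Z 0 \<in> borel_measurable M" "Z h \<in> borel_measurable M"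
    using sq s h by (auto simp: square_integrable_def)
  have "expectation (\<lambda>\<omega>. (\<Sum>i<2. D i \<omega>)\<^sup>2) = variance (Z (s + h))"
  proof (rule integral_cong_AE)
    show "AE \<omega> in M. (\<Sum>i<2. D i \<omega>)\<^sup>2 = (Z (s + h) \<omega> - expectation (Z (s + h)))\<^sup>2"
      using levy_zero
    proof eventually_elim
      case (elim \<omega>)
      then have "(\<Sum>i<2. D i \<omega>) = Z (s + h) \<omega> - expectation (Z (s + h))"
        unfolding levy_mean_additive[OF s h] by (simp add: D_def r_def e_def numeral_2_eq_2)
      then show ?case by (simp only:)
    qed
  qed (auto simp: D_def r_def numeral_2_eq_2)
  moreover have "expectation (\<lambda>\<omega>. (D 0 \<omega>)\<^sup>2) = variance (Z s)"
    using levy_zero by (intro integral_cong_AE) (auto simp: D_def r_def e_def)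
  moreover have "expectation (\<lambda>\<omega>. (D 1 \<omega>)\<^sup>2) = variance (Z h)"
    using levy_increment_distr[OF s h, of "\<lambda>x. (x - expectation (Z h))\<^sup>2"]
    by (simp add: D_def r_def e_def)
  ultimately show ?thesis using * by (simp add: numeral_2_eq_2)
qed

text \<open>Additivity and nonnegativity make the variance monotone, so it is bounded on \<open>[0, 1]\<close>.\<close>
lemma levy_variance_linear:
  assumes "0 \<le> t"
  shows "variance (Z t) = t * variance (Z 1)"
proof (rule additive_locally_bounded_imp_linear[where d = 1 and K = "variance (Z 1)"])
  fix h :: real assume "0 \<le> h" "h \<le> 1"
  then have "variance (Z 1) = variance (Z h) + variance (Z (1 - h))"
    using levy_variance_additive[of h "1 - h"] by simp
  then show "\<bar>variance (Z h)\<bar> \<le> variance (Z 1)" by (simp add: variance_positive)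
qed (use assms levy_variance_additive in auto)

text \<open>By stochastic continuity \<open>Z h\<close> is small with high probability for small \<open>h\<close>, and by
  Chebyshev's inequality it is close to its mean with high probability, since its variance is
  proportional to \<open>h\<close>. Hence the mean is locally bounded.\<close>
lemma levy_mean_linear:
  assumes "0 \<le> t"
  shows "expectation (Z t) = t * expectation (Z 1)"
proof -
  have "\<forall>t\<ge>0. \<forall>\<epsilon>>0.
      ((\<lambda>s. prob {\<omega> \<in> space M. \<bar>Z s \<omega> - Z t \<omega>\<bar> > \<epsilon>}) \<longlongrightarrow> 0) (at t within {0..})"
    using levy unfolding levy_process_def by (elim conjE) assumption
  from this[rule_format, of 0 "1/2"]
  have "((\<lambda>s. prob {\<omega> \<in> space M. \<bar>Z s \<omega> - Z 0 \<omega>\<bar> > 1/2}) \<longlongrightarrow> 0) (at 0 within {0..})"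
    by simp
  then have "\<forall>\<^sub>F s in at 0 within {0..}. prob {\<omega> \<in> space M. \<bar>Z s \<omega> - Z 0 \<omega>\<bar> > 1/2} < 1/2"
    by (rule order_tendstoD) simp
  then obtain d where d: "d > 0" and small:
      "\<And>s. s > 0 \<Longrightarrow> s < d \<Longrightarrow> prob {\<omega> \<in> space M. \<bar>Z s \<omega> - Z 0 \<omega>\<bar> > 1/2} < 1/2"
    unfolding eventually_at by (auto simp: dist_real_def)
  define V where "V = variance (Z 1)"
  have V: "0 \<le> V" by (simp add: V_def variance_positive)
  \<comment> \<open>The second bound makes the Chebyshev estimate \<open>4 h V\<close> below at most 1/2.\<close>
  define \<delta> where "\<delta> = min (d / 2) (1 / (8 * (V + 1)))"
  have \<delta>: "0 < \<delta>" using d V by (simp add: \<delta>_def)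
  have bound: "\<bar>expectation (Z h)\<bar> \<le> 1" if h: "0 \<le> h" "h \<le> \<delta>" for h
  proof (cases "h = 0")
    case True
    have "expectation (Z 0) = 0"
      using integral_cong_AE[of "Z 0" M "\<lambda>_. 0"] levy_zero levy_integrable[of 0] by simp
    then show ?thesis using True by simp
  next
    case False
    show ?thesis
    proof (rule ccontr)
      assume big: "\<not> \<bar>expectation (Z h)\<bar> \<le> 1"
      have [measurable]: "Z 0 \<in> borel_measurable M" "Z h \<in> borel_measurable M"
        using sq h by (auto simp: square_integrable_def)
      \<comment> \<open>If the mean exceeded 1 in absolute value, then \<open>Z h\<close> would almost surely be far from 0 or from its mean; but
        both events together have probability less than 1.\<close>
      let ?A = "{\<omega> \<in> space M. \<bar>Z h \<omega> - Z 0 \<omega>\<bar> > 1/2}"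
      let ?B = "{\<omega> \<in> space M. 1/2 \<le> \<bar>Z h \<omega> - expectation (Z h)\<bar>}"
      have "prob ?B \<le> variance (Z h) / (1/2)\<^sup>2"
        using sq[OF h(1)] by (intro Chebyshev_inequality) (auto simp: square_integrable_def)
      also have "\<dots> = 4 * h * V"
        using levy_variance_linear[OF h(1)] by (simp add: V_def power2_eq_square)
      also have "\<dots> \<le> 4 * (1 / (8 * (V + 1))) * V"
        using h V by (intro mult_right_mono mult_left_mono) (auto simp: \<delta>_def)
      also have "\<dots> \<le> 1/2" using V by (simp add: field_simps)
      finally have B: "prob ?B \<le> 1/2" .
      have "AE \<omega> in M. \<omega> \<in> ?A \<union> ?B"
        using levy_zero AE_space
      proof eventually_elim
        case (elim \<omega>)
        have "1/2 < \<bar>Z h \<omega>\<bar> \<or> 1/2 \<le> \<bar>Z h \<omega> - expectation (Z h)\<bar>"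
          using big by arith
        then show ?case using elim by simp
      qed
      then have "prob (?A \<union> ?B) = 1" by (intro prob_eq_1[THEN iffD2]) auto
      moreover have "prob (?A \<union> ?B) \<le> prob ?A + prob ?B"
        by (intro measure_Un_le) auto
      moreover have "prob ?A < 1/2" using small[of h] h False d by (auto simp: \<delta>_def)
      ultimately show False using B by linarith
    qed
  qed
  show ?thesis
    by (rule additive_locally_bounded_imp_linear[OF _ \<delta> bound assms])
      (auto intro: levy_mean_additive)
qed

text \<open>The square of the mean \<open>E[Z 1] * (\<Sum>i<n. c i * (s (Suc i) - s i))\<close> is estimated by the
  Cauchy--Schwarz inequality with weights \<open>s (Suc i) - s i\<close>, whose total is at most \<open>t\<close>; the
  centred part is a sum of uncorrelated terms.\<close>
lemma step_integral_second_moment: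
  assumes mono: "\<And>i. i < n \<Longrightarrow> s i \<le> s (Suc i)" and s0: "0 \<le> s 0" and st: "s n \<le> t"
  shows "square_integrable M (step_integral Z n s c)"
    and "expectation (\<lambda>\<omega>. (step_integral Z n s c \<omega>)\<^sup>2) \<le>
           (variance (Z 1) + t * (expectation (Z 1))\<^sup>2) * (\<Sum>i<n. (c i)\<^sup>2 * (s (Suc i) - s i))"
proof -
  define V where "V = variance (Z 1)"
  define m where "m = expectation (Z 1)"
  \<comment> \<open>The breakpoints are continued constantly after \<open>n\<close>, because independence of increments is stated
    for monotone infinite sequences.\<close>
  define r where "r i = s (min i n)" for i
  define \<Delta> where "\<Delta> i = r (Suc i) - r i" for i
  have r: "incseq r"
  proof (rule incseq_SucI)
    show "r i \<le> r (Suc i)" for i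
      using mono[of i] by (cases "i < n") (auto simp: r_def)
  qed
  have rs: "r i = s i" if "i \<le> n" for i using that by (simp add: r_def)
  have r0: "0 \<le> r i" for i
    using incseqD[OF r, of 0 i] s0 by (simp add: rs)
  have \<Delta>0: "0 \<le> \<Delta> i" for i using incseq_SucD[OF r] by (simp add: \<Delta>_def)
  define D where "D = (\<lambda>i \<omega>. c i * (Z (r (Suc i)) \<omega> - Z (r i) \<omega> - \<Delta> i * m))"
  define b where "b = m * (\<Sum>i<n. c i * \<Delta> i)"
  have inc_sq: "square_integrable M (\<lambda>\<omega>. Z (r (Suc i)) \<omega> - Z (r i) \<omega>)" for i
    by (intro levy_increment_square_integrable r0)
  have S: "step_integral Z n s c = (\<lambda>\<omega>. \<Sum>i<n. c i * (Z (r (Suc i)) \<omega> - Z (r i) \<omega>))"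
    by (intro ext) (simp add: step_integral_def rs)
  show "square_integrable M (step_integral Z n s c)"
    unfolding S by (intro square_integrable_sum square_integrable_cmult inc_sq) auto
  have D_sq: "square_integrable M (D i)" for i
    unfolding D_def
    by (intro square_integrable_cmult square_integrable_diff[OF inc_sq])
      (simp add: square_integrable_def)
  have mean_inc: "expectation (\<lambda>\<omega>. Z (r (Suc i)) \<omega> - Z (r i) \<omega>) = \<Delta> i * m" for i
    using r0[of i] r0[of "Suc i"] levy_mean_linear[of "r i"] levy_mean_linear[of "r (Suc i)"]
    by (simp add: levy_integrable \<Delta>_def m_def algebra_simps)
  have inc_int: "integrable M (\<lambda>\<omega>. Z (r (Suc i)) \<omega> - Z (r i) \<omega>)" for i
    using r0 by (intro Bochner_Integration.integrable_diff levy_integrable)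
  have D_mean: "expectation (D i) = 0" for i
    using mean_inc[of i] inc_int[of i] by (simp add: D_def prob_space)
  have D_int: "integrable M (D i)" for i
    using D_sq[of i] square_integrable_imp_integrable by (auto simp: square_integrable_def)
  have "indep_vars (\<lambda>_. borel) D {..<n}"
    unfolding D_def
    by (rule indep_vars_compose2[OF levy_increments_indep[OF r r0],
          where Y = "\<lambda>i x. c i * (x - \<Delta> i * m)"]) simp
  then have "expectation (\<lambda>\<omega>. (\<Sum>i<n. D i \<omega>)\<^sup>2) = (\<Sum>i<n. expectation (\<lambda>\<omega>. (D i \<omega>)\<^sup>2))"
    by (intro expectation_square_sum_indep D_sq D_mean)
  also have "\<dots> = (\<Sum>i<n. (c i)\<^sup>2 * (\<Delta> i * V))"
  proof (rule sum.cong[OF refl])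
    fix i
    have "expectation (\<lambda>\<omega>. (D i \<omega>)\<^sup>2) =
        (c i)\<^sup>2 * expectation (\<lambda>\<omega>. (Z (r i + \<Delta> i) \<omega> - Z (r i) \<omega> - \<Delta> i * m)\<^sup>2)"
      by (simp add: D_def power_mult_distrib \<Delta>_def)
    also have "expectation (\<lambda>\<omega>. (Z (r i + \<Delta> i) \<omega> - Z (r i) \<omega> - \<Delta> i * m)\<^sup>2) =
        expectation (\<lambda>\<omega>. (Z (\<Delta> i) \<omega> - \<Delta> i * m)\<^sup>2)"
      using levy_increment_distr[OF r0 \<Delta>0, of "\<lambda>x. (x - \<Delta> i * m)\<^sup>2" i i] by simp
    also have "\<dots> = \<Delta> i * V"
      using levy_variance_linear[OF \<Delta>0] levy_mean_linear[OF \<Delta>0] by (simp add: V_def m_def)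
    finally show "expectation (\<lambda>\<omega>. (D i \<omega>)\<^sup>2) = (c i)\<^sup>2 * (\<Delta> i * V)" .
  qed
  also have "\<dots> = V * (\<Sum>i<n. (c i)\<^sup>2 * \<Delta> i)" by (simp add: sum_distrib_left mult_ac)
  finally have centred: "expectation (\<lambda>\<omega>. (\<Sum>i<n. D i \<omega>)\<^sup>2) = V * (\<Sum>i<n. (c i)\<^sup>2 * \<Delta> i)" .
  have "(\<Sum>i<n. c i * \<Delta> i)\<^sup>2 = (\<Sum>i<n. (c i * sqrt (\<Delta> i)) * sqrt (\<Delta> i))\<^sup>2"
    using \<Delta>0 by (simp add: mult.assoc)
  also have "\<dots> \<le> (\<Sum>i<n. (c i * sqrt (\<Delta> i))\<^sup>2) * (\<Sum>i<n. (sqrt (\<Delta> i))\<^sup>2)"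
    by (rule Cauchy_Schwarz_ineq_sum)
  also have "\<dots> = (\<Sum>i<n. (c i)\<^sup>2 * \<Delta> i) * (r n - r 0)"
    using \<Delta>0 by (simp add: power_mult_distrib sum_lessThan_telescope \<Delta>_def)
  also have "\<dots> \<le> (\<Sum>i<n. (c i)\<^sup>2 * \<Delta> i) * t"
    using s0 st \<Delta>0 by (intro mult_left_mono sum_nonneg) (auto simp: rs)
  finally have "(\<Sum>i<n. c i * \<Delta> i)\<^sup>2 \<le> (\<Sum>i<n. (c i)\<^sup>2 * \<Delta> i) * t" .
  from mult_left_mono[OF this, of "m\<^sup>2"]
  have drift: "b\<^sup>2 \<le> t * m\<^sup>2 * (\<Sum>i<n. (c i)\<^sup>2 * \<Delta> i)"
    by (simp add: b_def power_mult_distrib mult_ac)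
  have "expectation (\<lambda>\<omega>. (step_integral Z n s c \<omega>)\<^sup>2) =
      expectation (\<lambda>\<omega>. (\<Sum>i<n. D i \<omega>)\<^sup>2 + 2 * b * (\<Sum>i<n. D i \<omega>) + b\<^sup>2)"
  proof (rule Bochner_Integration.integral_cong[OF refl])
    fix \<omega>
    have "step_integral Z n s c \<omega> = (\<Sum>i<n. D i \<omega>) + b"
      by (simp add: S D_def b_def algebra_simps sum.distrib sum_subtractf sum_distrib_left)
    then show "(step_integral Z n s c \<omega>)\<^sup>2 =
        (\<Sum>i<n. D i \<omega>)\<^sup>2 + 2 * b * (\<Sum>i<n. D i \<omega>) + b\<^sup>2"
      by (simp add: power2_sum)
  qed
  also have "\<dots> = V * (\<Sum>i<n. (c i)\<^sup>2 * \<Delta> i) + b\<^sup>2"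
  proof -
    have "square_integrable M (\<lambda>\<omega>. \<Sum>i<n. D i \<omega>)"
      by (intro square_integrable_sum D_sq) auto
    then show ?thesis
      using centred D_int by (simp add: square_integrable_def D_mean prob_space)
  qed
  also have "\<dots> \<le> (V + t * m\<^sup>2) * (\<Sum>i<n. (c i)\<^sup>2 * \<Delta> i)"
    using drift by (simp add: algebra_simps)
  finally show "expectation (\<lambda>\<omega>. (step_integral Z n s c \<omega>)\<^sup>2) \<le>
      (variance (Z 1) + t * (expectation (Z 1))\<^sup>2) * (\<Sum>i<n. (c i)\<^sup>2 * (s (Suc i) - s i))"
    by (simp add: V_def m_def \<Delta>_def rs)
qed

end

end

section \<open>Second moments of stochastic integrals\<close>

lemma l2norm_tendsto_0:
  assumes "\<And>k. f k \<in> borel_measurable N"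
    and "(\<lambda>k. \<integral>\<^sup>+x. ennreal ((f k x)\<^sup>2) \<partial>N) \<longlonglongrightarrow> 0"
  shows "(\<lambda>k. l2norm N (f k)) \<longlonglongrightarrow> 0"
proof -
  have "l2norm N (f k) = sqrt (enn2real (\<integral>\<^sup>+x. ennreal ((f k x)\<^sup>2) \<partial>N))" for k
    unfolding l2norm_def using assms(1) by (subst integral_eq_nn_integral) auto
  moreover have "(\<lambda>k. sqrt (enn2real (\<integral>\<^sup>+x. ennreal ((f k x)\<^sup>2) \<partial>N))) \<longlonglongrightarrow> sqrt 0"
    using assms(2) by (intro tendsto_real_sqrt tendsto_enn2real) auto
  ultimately show ?thesis by simp
qed

abbreviation lebesgue_Icc :: "real \<Rightarrow> real measure" where
  "lebesgue_Icc t \<equiv> restrict_space lborel {0..t}"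

lemma square_integrable_Icc:
  assumes "f \<in> borel_measurable borel" "\<And>u. \<lbrakk>0 \<le> u; u \<le> t\<rbrakk> \<Longrightarrow> \<bar>f u\<bar> \<le> K"
  shows "square_integrable (lebesgue_Icc t) f"
proof (rule square_integrable_bound)
  have "finite_measure (lebesgue_Icc t)"
    by (rule finite_measureI, cases "0 \<le> t")
      (simp_all add: emeasure_restrict_space space_restrict_space)
  then show "square_integrable (lebesgue_Icc t) (\<lambda>_. K)"
    by (simp add: square_integrable_def finite_measure.integrable_const)
  show "f \<in> borel_measurable (lebesgue_Icc t)"
    using assms(1) by (intro measurable_restrict_space1) simp
qed (use assms(2) in \<open>auto simp: space_restrict_space\<close>)

lemma step_fun_square_integrable: "square_integrable (lebesgue_Icc t) (step_fun n s c)"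
  unfolding step_fun_def[abs_def]
  by (intro square_integrable_sum square_integrable_cmult square_integrable_Icc[where K = 1])
    (auto simp: indicator_def)

text \<open>The intervals \<open>{s i<..s (Suc i)}\<close> are disjoint, so all mixed products vanish.\<close>
lemma step_fun_sq:
  assumes "\<And>i. i < n \<Longrightarrow> s i \<le> s (Suc i)"
  shows "(step_fun n s c u)\<^sup>2 = (\<Sum>i<n. (c i)\<^sup>2 * indicator {s i<..s (Suc i)} u)"
  using assms
proof (induction n)
  case 0
  show ?case by (simp add: step_fun_def)
next
  case (Suc n)
  have mono: "s i \<le> s n" if "i \<le> n" for i
    using that
  proof (induction rule: inc_induct)
    case (step k)
    then show ?case using Suc.prems[of k] by simp
  qed simp
  have zero: "step_fun n s c u = 0" if "s n < u"
    unfolding step_fun_def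
  proof (intro sum.neutral ballI)
    fix i assume "i \<in> {..<n}"
    then show "c i * indicator {s i<..s (Suc i)} u = 0" using mono[of "Suc i"] that by auto
  qed
  have "step_fun (Suc n) s c u = step_fun n s c u + c n * indicator {s n<..s (Suc n)} u"
    by (simp add: step_fun_def)
  moreover have "(step_fun n s c u + c n * indicator {s n<..s (Suc n)} u)\<^sup>2 =
      (step_fun n s c u)\<^sup>2 + (c n)\<^sup>2 * indicator {s n<..s (Suc n)} u"
    using zero by (auto simp: indicator_def)
  ultimately show ?case using Suc by simp
qed

lemma step_fun_l2norm:
  assumes mono: "\<And>i. i < n \<Longrightarrow> s i \<le> s (Suc i)" and s0: "0 \<le> s 0" and st: "s n \<le> t"
  shows "(l2norm (lebesgue_Icc t) (step_fun n s c))\<^sup>2 = (\<Sum>i<n. (c i)\<^sup>2 * (s (Suc i) - s i))"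
proof -
  have le_n: "s i \<le> s n" if "i \<le> n" for i
    using that
  proof (induction rule: inc_induct)
    case (step k)
    then show ?case using mono[of k] by simp
  qed simp
  have ge_0: "s 0 \<le> s i" if "i \<le> n" for i
    using that
  proof (induction i)
    case (Suc i)
    then show ?case using mono[of i] by simp
  qed simp
  have "(l2norm (lebesgue_Icc t) (step_fun n s c))\<^sup>2 =
      (\<integral>u. indicator {0..t} u * (step_fun n s c u)\<^sup>2 \<partial>lborel)"
    unfolding l2norm_sq by (subst integral_restrict_space) auto
  also have "\<dots> = (\<integral>u. (\<Sum>i<n. (c i)\<^sup>2 * indicator {s i<..s (Suc i)} u) \<partial>lborel)"
  proof (rule Bochner_Integration.integral_cong[OF refl])
    fix u
    have "indicator {0..t} u * indicator {s i<..s (Suc i)} u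
        = (indicator {s i<..s (Suc i)} u :: real)" if "i < n" for i
      using ge_0[of i] le_n[of "Suc i"] that s0 st by (auto simp: indicator_def)
    then have *: "indicator {0..t} u * ((c i)\<^sup>2 * indicator {s i<..s (Suc i)} u)
        = (c i)\<^sup>2 * indicator {s i<..s (Suc i)} u" if "i < n" for i
      using that by (simp only: mult.left_commute[of "indicator {0..t} u"])
    have "(step_fun n s c u)\<^sup>2 = (\<Sum>i<n. (c i)\<^sup>2 * indicator {s i<..s (Suc i)} u)"
      by (rule step_fun_sq) (rule mono)
    then show "indicator {0..t} u * (step_fun n s c u)\<^sup>2 =
        (\<Sum>i<n. (c i)\<^sup>2 * indicator {s i<..s (Suc i)} u)"
      by (simp only: sum_distrib_left) (intro sum.cong refl *, simp)
  qed
  also have "\<dots> = (\<Sum>i<n. (c i)\<^sup>2 * (s (Suc i) - s i))"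
    by (subst Bochner_Integration.integral_sum) (auto intro!: sum.cong simp: mono)
  finally show ?thesis .
qed

text \<open>
  The bound for step functions passes to the limit: the step integrals \<open>S k\<close> tend to \<open>J\<close> in \<open>L\<^sup>2(\<Omega>)\<close>, their norms are controlled by those of the step functions \<open>g k\<close>, and the latter
  tend to the norm of \<open>f\<close>.
\<close>
lemma (in prob_space) stoch_integral_l2norm_le:
  assumes levy: "real_levy_process M Z"
    and sq: "\<And>t. 0 \<le> t \<Longrightarrow> square_integrable M (Z t)"
    and f: "square_integrable (lebesgue_Icc t) f" and t: "0 \<le> t"
    and J: "has_stoch_integral M Z t f J"
  shows "l2norm M J \<le>
    sqrt (variance (Z 1) + t * (expectation (Z 1))\<^sup>2) * l2norm (lebesgue_Icc t) f"
proof -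
  define K where "K = variance (Z 1) + t * (expectation (Z 1))\<^sup>2"
  have K: "0 \<le> K" using t by (simp add: K_def variance_positive)
  have J_sq: "square_integrable M J" using J by (simp add: has_stoch_integral_def square_integrable_def)
  obtain n s c where partition:
        "\<forall>k. (\<forall>i<n k. s k i \<le> s k (Suc i)) \<and> 0 \<le> s k 0 \<and> s k (n k) \<le> t"
      and limf: "(\<lambda>k. \<integral>\<^sup>+u\<in>{0..t}. ennreal ((f u - step_fun (n k) (s k) (c k) u)\<^sup>2) \<partial>lborel)
        \<longlonglongrightarrow> 0"
      and limJ: "(\<lambda>k. \<integral>\<^sup>+\<omega>. ennreal ((J \<omega> - step_integral Z (n k) (s k) (c k) \<omega>)\<^sup>2) \<partial>M)
        \<longlonglongrightarrow> 0"
    using J unfolding has_stoch_integral_def by (elim conjE exE)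
  have mono: "s k i \<le> s k (Suc i)" if "i < n k" for k i using partition that by simp
  have s0: "0 \<le> s k 0" and st: "s k (n k) \<le> t" for k using partition by simp_all
  define g where "g k = step_fun (n k) (s k) (c k)" for k
  define S where "S k = step_integral Z (n k) (s k) (c k)" for k
  have g_sq: "square_integrable (lebesgue_Icc t) (g k)" for k
    unfolding g_def by (rule step_fun_square_integrable)
  have S_sq: "square_integrable M (S k)" for k
    unfolding S_def by (rule step_integral_second_moment(1)[OF levy sq]) (use mono s0 st in auto)
  have "(\<lambda>k. l2norm M (\<lambda>\<omega>. J \<omega> - S k \<omega>)) \<longlonglongrightarrow> 0"
    using limJ square_integrable_diff[OF J_sq S_sq]
    by (intro l2norm_tendsto_0) (auto simp: S_def square_integrable_def)
  moreover have "(\<lambda>k. l2norm (lebesgue_Icc t) (\<lambda>u. f u - g k u)) \<longlonglongrightarrow> 0"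
    using limf square_integrable_diff[OF f g_sq]
    by (intro l2norm_tendsto_0) (auto simp: g_def square_integrable_def nn_integral_restrict_space)
  ultimately have lim: "(\<lambda>k. l2norm M (\<lambda>\<omega>. J \<omega> - S k \<omega>) + sqrt K *
      (l2norm (lebesgue_Icc t) f + l2norm (lebesgue_Icc t) (\<lambda>u. f u - g k u)))
      \<longlonglongrightarrow> 0 + sqrt K * (l2norm (lebesgue_Icc t) f + 0)"
    by (intro tendsto_add tendsto_mult tendsto_const)
  have "l2norm M J \<le> l2norm M (\<lambda>\<omega>. J \<omega> - S k \<omega>) + sqrt K *
      (l2norm (lebesgue_Icc t) f + l2norm (lebesgue_Icc t) (\<lambda>u. f u - g k u))" for k
  proof -
    have g_norm: "(l2norm (lebesgue_Icc t) (g k))\<^sup>2 = (\<Sum>i<n k. (c k i)\<^sup>2 * (s k (Suc i) - s k i))"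
      unfolding g_def by (rule step_fun_l2norm) (simp_all add: mono s0 st)
    have "(l2norm M (S k))\<^sup>2 \<le>
        K * (\<Sum>i<n k. (c k i)\<^sup>2 * (s k (Suc i) - s k i))"
      unfolding l2norm_sq S_def K_def
      by (rule step_integral_second_moment(2)[OF levy sq]) (simp_all add: mono s0 st)
    then have "(l2norm M (S k))\<^sup>2 \<le> K * (l2norm (lebesgue_Icc t) (g k))\<^sup>2"
      unfolding g_norm .
    then have "l2norm M (S k) \<le> sqrt K * l2norm (lebesgue_Icc t) (g k)"
      using K by - (rule power2_le_imp_le, simp_all add: power_mult_distrib)
    also have "\<dots> \<le> sqrt K *
        (l2norm (lebesgue_Icc t) f + l2norm (lebesgue_Icc t) (\<lambda>u. f u - g k u))"
      using l2norm_diff_bound[OF f g_sq, of k] K by (intro mult_left_mono) auto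
    finally show ?thesis
      using l2norm_diff_bound[OF J_sq S_sq, of k] by linarith
  qed
  then have "l2norm M J \<le> 0 + sqrt K * (l2norm (lebesgue_Icc t) f + 0)"
    by (intro LIMSEQ_le_const[OF lim] exI allI impI)
  then show ?thesis by (simp add: K_def)
qed

lemma exp_kernel_l2norm:
  assumes "0 < a" "0 \<le> t"
  shows "square_integrable (lebesgue_Icc t) (\<lambda>s. exp (- a * (t - s)))"
    and "(l2norm (lebesgue_Icc t) (\<lambda>s. exp (- a * (t - s))))\<^sup>2 \<le> 1 / (2 * a)"
proof -
  show "square_integrable (lebesgue_Icc t) (\<lambda>s. exp (- a * (t - s)))"
    by (rule square_integrable_Icc[where K = 1]) (use assms in auto)
  have "(l2norm (lebesgue_Icc t) (\<lambda>s. exp (- a * (t - s))))\<^sup>2 =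
      (\<integral>s. indicator {0..t} s *\<^sub>R (exp (- a * (t - s)))\<^sup>2 \<partial>lborel)"
    unfolding l2norm_sq by (subst integral_restrict_space) auto
  also have "\<dots> = exp (- 2 * a * (t - t)) / (2 * a) - exp (- 2 * a * (t - 0)) / (2 * a)"
  proof (rule integral_FTC_Icc[OF assms(2)])
    fix x
    have "((\<lambda>s. exp (- 2 * a * (t - s)) / (2 * a)) has_real_derivative exp (- 2 * a * (t - x)))
        (at x within {0..t})"
      using assms by (auto intro!: derivative_eq_intros)
    moreover have "exp (- 2 * a * (t - x)) = (exp (- a * (t - x)))\<^sup>2"
      by (simp add: exp_double[symmetric] power2_eq_square exp_add[symmetric] algebra_simps)
    ultimately show "((\<lambda>s. exp (- 2 * a * (t - s)) / (2 * a)) has_vector_derivative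
        (exp (- a * (t - x)))\<^sup>2) (at x within {0..t})"
      by (simp add: has_real_derivative_iff_has_vector_derivative)
  qed (auto intro!: continuous_intros)
  also have "\<dots> \<le> 1 / (2 * a)" using assms by simp
  finally show "(l2norm (lebesgue_Icc t) (\<lambda>s. exp (- a * (t - s))))\<^sup>2 \<le> 1 / (2 * a)" .
qed

text \<open>The bound is uniform in \<open>t \<le> T\<close>, which makes the constant of the error estimate independent of
  the time.\<close>
lemma (in prob_space) stoch_convolution_second_moment:
  assumes levy: "real_levy_process M Z"
    and sq: "\<And>t. 0 \<le> t \<Longrightarrow> square_integrable M (Z t)"
    and a: "0 < a" and t: "0 \<le> t" "t \<le> T"
    and J: "has_stoch_integral M Z t (\<lambda>s. exp (- a * (t - s))) J"
  shows "expectation (\<lambda>\<omega>. (J \<omega>)\<^sup>2) \<le> (variance (Z 1) + T * (expectation (Z 1))\<^sup>2) / (2 * a)"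
proof -
  define K where "K = variance (Z 1) + t * (expectation (Z 1))\<^sup>2"
  have K: "0 \<le> K" using t by (simp add: K_def variance_positive)
  have "(l2norm M J)\<^sup>2 \<le>
      (sqrt K * l2norm (lebesgue_Icc t) (\<lambda>s. exp (- a * (t - s))))\<^sup>2"
    using stoch_integral_l2norm_le[OF levy sq exp_kernel_l2norm(1)[OF a t(1)] t(1) J]
    by (intro power_mono) (auto simp: K_def)
  also have "\<dots> = K * (l2norm (lebesgue_Icc t) (\<lambda>s. exp (- a * (t - s))))\<^sup>2"
    using K by (simp add: power_mult_distrib)
  also have "\<dots> \<le> K * (1 / (2 * a))"
    by (intro mult_left_mono exp_kernel_l2norm(2) a t K)
  also have "\<dots> \<le> (variance (Z 1) + T * (expectation (Z 1))\<^sup>2) / (2 * a)"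
    using t a by (auto simp: K_def intro!: divide_right_mono mult_right_mono)
  finally show ?thesis by (simp add: l2norm_sq)
qed

section \<open>Random functions on the sphere\<close>

lemma L2_norm_eq_l2norm: "L2_norm M nrm Z = l2norm M (\<lambda>\<omega>. nrm (Z \<omega>))"
  by (simp add: L2_norm_def l2norm_def)

lemma space_norm_borel: "space (norm_borel S nrm) = S"
  unfolding norm_borel_def by (intro space_measure_of) auto

lemma L2_rv_in_space: "L2_rv M S nrm Z \<Longrightarrow> \<omega> \<in> space M \<Longrightarrow> Z \<omega> \<in> S"
  unfolding L2_rv_def using measurable_space space_norm_borel by metis

lemma sphere_norm_eq_l2norm: "sphere_norm f = l2norm sphere_measure f"
  by (simp add: sphere_norm_def sphere_inner_def l2norm_def power2_eq_square)

lemma L2_sphere_iff: "f \<in> L2_sphere \<longleftrightarrow> square_integrable sphere_measure f"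
  by (simp add: L2_sphere_def square_integrable_def)

lemma sphere_norm_diff_bound:
  assumes "f \<in> L2_sphere" "g \<in> L2_sphere"
  shows "\<bar>sphere_norm g - sphere_norm f\<bar> \<le> sphere_norm (g - f)"
  using l2norm_diff_bound[of sphere_measure g f] assms
  by (simp add: sphere_norm_eq_l2norm L2_sphere_iff fun_diff_def)

lemma sphere_norm_nonneg [simp]: "0 \<le> sphere_norm f"
  by (simp add: sphere_norm_eq_l2norm)

lemma sphere_norm_measurable: "sphere_norm \<in> borel_measurable (norm_borel L2_sphere sphere_norm)"
  by (rule Lipschitz_measurable_norm_borel[where K = 1]) (simp_all add: sphere_norm_diff_bound)

lemma sphere_inner_Cauchy_Schwarz:
  assumes "f \<in> L2_sphere" "g \<in> L2_sphere"
  shows "\<bar>sphere_inner f g\<bar> \<le> sphere_norm f * sphere_norm g"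
  using integral_Cauchy_Schwarz assms
  by (auto simp: sphere_norm_eq_l2norm sphere_inner_def L2_sphere_iff)

lemma sphere_inner_measurable:
  assumes e: "e \<in> L2_sphere"
  shows "(\<lambda>f. sphere_inner f e) \<in> borel_measurable (norm_borel L2_sphere sphere_norm)"
proof (rule Lipschitz_measurable_norm_borel[where K = "sphere_norm e"])
  fix f g assume fg: "f \<in> L2_sphere" "g \<in> L2_sphere"
  then have "sphere_inner g e - sphere_inner f e = sphere_inner (g - f) e"
    using e by (simp add: sphere_inner_def L2_sphere_iff left_diff_distrib square_integrable_mult)
  moreover have "g - f \<in> L2_sphere"
    using fg by (simp add: L2_sphere_iff fun_diff_def square_integrable_diff)
  ultimately show "\<bar>sphere_inner g e - sphere_inner f e\<bar> \<le> sphere_norm e * sphere_norm (g - f)"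
    using sphere_inner_Cauchy_Schwarz[of "g - f" e] e by (simp add: mult.commute)
qed simp_all

lemma L2_rv_sphere:
  assumes "L2_rv M L2_sphere sphere_norm Z"
  shows "square_integrable M (\<lambda>\<omega>. sphere_norm (Z \<omega>))"
    and "e \<in> L2_sphere \<Longrightarrow> square_integrable M (\<lambda>\<omega>. sphere_inner (Z \<omega>) e)"
proof -
  have Z: "Z \<in> measurable M (norm_borel L2_sphere sphere_norm)"
    using assms by (simp add: L2_rv_def)
  show sq: "square_integrable M (\<lambda>\<omega>. sphere_norm (Z \<omega>))"
    using assms measurable_compose[OF Z sphere_norm_measurable]
    by (simp add: L2_rv_def square_integrable_def)
  assume e: "e \<in> L2_sphere"
  show "square_integrable M (\<lambda>\<omega>. sphere_inner (Z \<omega>) e)"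
  proof (rule square_integrable_bound)
    show "square_integrable M (\<lambda>\<omega>. sphere_norm e * sphere_norm (Z \<omega>))"
      by (rule square_integrable_cmult[OF sq])
    show "(\<lambda>\<omega>. sphere_inner (Z \<omega>) e) \<in> borel_measurable M"
      by (rule measurable_compose[OF Z sphere_inner_measurable[OF e]])
    show "\<bar>sphere_inner (Z \<omega>) e\<bar> \<le> sphere_norm e * sphere_norm (Z \<omega>)" if "\<omega> \<in> space M" for \<omega>
      using sphere_inner_Cauchy_Schwarz[OF L2_rv_in_space[OF assms that] e]
      by (simp add: mult.commute)
  qed
qed

section \<open>The truncation error\<close>

definition sh_band :: "nat set \<Rightarrow> (nat \<times> int) set" where
  "sh_band A = Sigma A (\<lambda>l. {-int l..int l})"

lemma finite_sh_band [simp]: "finite A \<Longrightarrow> finite (sh_band A)"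
  by (simp add: sh_band_def)

lemma sh_band_index: "i \<in> sh_band A \<Longrightarrow> i \<in> sh_index"
  by (auto simp: sh_band_def sh_index_def)

lemma sum_sh_band:
  "finite A \<Longrightarrow> (\<Sum>l\<in>A. \<Sum>m=-int l..int l. g l m) = (\<Sum>(l, m)\<in>sh_band A. g l m)"
  by (simp add: sh_band_def sum.Sigma)

text \<open>
  The decomposition of the error: \<open>n\<close> tends to infinity at fixed \<open>\<kappa>\<close>, so the noise of degrees
  \<open>\<kappa> < l \<le> n\<close> must be bounded by a number \<open>R\<close> that does not depend on \<open>n\<close>.
\<close>
lemma spectral_error_le:
  fixes M :: "'w measure" and J :: "nat \<Rightarrow> int \<Rightarrow> real \<Rightarrow> 'w \<Rightarrow> real"
  assumes harmonics: "real_spherical_harmonics Y"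
    and X0: "L2_rv M L2_sphere sphere_norm X0"
    and X: "L2_rv M L2_sphere sphere_norm Xt"
    and t: "0 \<le> t"
    and J: "\<And>l m. (l, m) \<in> sh_index \<Longrightarrow> square_integrable M (J l m t)"
    and J_le: "\<And>l m. (l, m) \<in> sh_band {\<kappa><..} \<Longrightarrow> (\<integral>\<omega>. (J l m t \<omega>)\<^sup>2 \<partial>M) \<le> q l m"
    and q: "\<And>n. (\<Sum>(l, m)\<in>sh_band {\<kappa><..n}. q l m) \<le> R\<^sup>2" and R: "0 \<le> R"
    and X_series: "(\<lambda>n. L2_norm M sphere_norm (\<lambda>\<omega>. Xt \<omega> - spectral_approx Y X0 J n t \<omega>)) \<longlonglongrightarrow> 0"
  shows "L2_norm M sphere_norm (\<lambda>\<omega>. Xt \<omega> - spectral_approx Y X0 J \<kappa> t \<omega>) \<le>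
    exp (- (real \<kappa> + 1)\<^sup>2 * t) * L2_norm M sphere_norm X0 + R"
proof -
  define e where "e = (\<lambda>(l, m). Y l m)"
  define x0 where "x0 = (\<lambda>(l, m) \<omega>. exp (- sh_eigenvalue l * t) * sphere_inner (X0 \<omega>) (Y l m))"
  define j where "j = (\<lambda>(l, m). J l m t)"
  have e_L2: "e i \<in> L2_sphere" if "i \<in> sh_index" for i
    using harmonics that unfolding real_spherical_harmonics_def e_def by fastforce
  have orth: "sphere_inner (e i) (e k) = (if i = k then 1 else 0)"
    if "i \<in> sh_index" "k \<in> sh_index" for i k
  proof -
    have "\<forall>(l, m)\<in>sh_index. \<forall>(l', m')\<in>sh_index.
        sphere_inner (Y l m) (Y l' m') = (if l = l' \<and> m = m' then 1 else 0)"
      using harmonics unfolding real_spherical_harmonics_def by (elim conjE)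
    from bspec[OF this that(1)] that(2) show ?thesis
      by (cases i; cases k) (auto simp: e_def)
  qed
  have e_sq: "square_integrable sphere_measure (e i)" if "i \<in> sh_band A" for i A
    using e_L2[OF sh_band_index[OF that]] by (simp add: L2_sphere_iff)
  have e_orth: "(\<integral>x. e i x * e k x \<partial>sphere_measure) = (if i = k then 1 else 0)"
    if "i \<in> sh_band A" "k \<in> sh_band A" for i k A
    using orth[OF sh_band_index[OF that(1)] sh_band_index[OF that(2)]]
    by (simp add: sphere_inner_def)
  have x0_sq: "square_integrable M (x0 i)" if "i \<in> sh_index" for i
    using L2_rv_sphere(2)[OF X0 e_L2[OF that]]
    by (cases i) (simp add: x0_def e_def square_integrable_cmult)
  have j_sq: "square_integrable M (j i)" if "i \<in> sh_index" for i
    using J that by (cases i) (simp add: j_def)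
  have c_sq: "square_integrable M (\<lambda>\<omega>. x0 i \<omega> + j i \<omega>)" if "i \<in> sh_band A" for i A
    by (intro square_integrable_add x0_sq j_sq sh_band_index[OF that])
  have approx: "spectral_approx Y X0 J n t \<omega> x =
      (\<Sum>i\<in>sh_band {..n}. (x0 i \<omega> + j i \<omega>) * e i x)" for n \<omega> x
    unfolding spectral_approx_def
    by (subst sum_sh_band) (auto simp: x0_def j_def e_def case_prod_beta intro!: sum.cong)
  define err where "err n \<omega> = sphere_norm (Xt \<omega> - spectral_approx Y X0 J n t \<omega>)" for n \<omega>
  define tailj where "tailj n \<omega> = L2_set (\<lambda>i. j i \<omega>) (sh_band {\<kappa><..n})" for n \<omega>
  define E where "E = exp (- (real \<kappa> + 1)\<^sup>2 * t)"
  have Xt_sq: "square_integrable sphere_measure (Xt \<omega>)" if "\<omega> \<in> space M" for \<omega>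
    using L2_rv_in_space[OF X that] by (simp add: L2_sphere_iff)
  have approx_sq: "square_integrable sphere_measure (spectral_approx Y X0 J n t \<omega>)" for n \<omega>
    unfolding approx[abs_def] by (intro square_integrable_sum square_integrable_cmult e_sq) auto
  have approx_norm: "l2norm sphere_measure (\<lambda>x. \<Sum>i\<in>sh_band A. c i * e i x) = L2_set c (sh_band A)"
    if "finite A" for A c
    using that by (intro l2norm_orthonormal_sum finite_sh_band e_sq e_orth)
  have err_sq: "square_integrable M (err n)" for n
  proof (rule square_integrable_bound)
    let ?I = "sh_band {..n}"
    show "square_integrable M (\<lambda>\<omega>. sphere_norm (Xt \<omega>) + (\<Sum>i\<in>?I. \<bar>x0 i \<omega> + j i \<omega>\<bar>))"
    proof (intro square_integrable_add square_integrable_sum L2_rv_sphere(1)[OF X] finite_sh_band)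
      show "square_integrable M (\<lambda>\<omega>. \<bar>x0 i \<omega> + j i \<omega>\<bar>)" if "i \<in> ?I" for i
        using c_sq[OF that] by (auto simp: square_integrable_def)
    qed simp
    \<comment> \<open>Measurability of the error is read off from its expansion in the measurable coordinates.\<close>
    have eq: "err n \<omega> = sqrt ((sphere_norm (Xt \<omega>))\<^sup>2
        - 2 * (\<Sum>i\<in>?I. (x0 i \<omega> + j i \<omega>) * sphere_inner (Xt \<omega>) (e i))
        + (\<Sum>i\<in>?I. (x0 i \<omega> + j i \<omega>)\<^sup>2))" if "\<omega> \<in> space M" for \<omega>
    proof -
      have "(err n \<omega>)\<^sup>2 =
          (l2norm sphere_measure (\<lambda>x. Xt \<omega> x - (\<Sum>i\<in>?I. (x0 i \<omega> + j i \<omega>) * e i x)))\<^sup>2"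
        by (simp add: err_def sphere_norm_eq_l2norm fun_diff_def approx)
      also have "\<dots> = (sphere_norm (Xt \<omega>))\<^sup>2
          - 2 * (\<Sum>i\<in>?I. (x0 i \<omega> + j i \<omega>) * sphere_inner (Xt \<omega>) (e i))
          + (\<Sum>i\<in>?I. (x0 i \<omega> + j i \<omega>)\<^sup>2)"
        unfolding sphere_inner_def sphere_norm_eq_l2norm
        by (intro l2norm_diff_orthonormal_sq finite_sh_band Xt_sq[OF that] e_sq e_orth) simp
      finally show ?thesis
        by (intro real_sqrt_unique[symmetric]) (simp_all add: err_def)
    qed
    have [measurable]: "(\<lambda>\<omega>. sphere_norm (Xt \<omega>)) \<in> borel_measurable M"
      using L2_rv_sphere(1)[OF X] by (simp add: square_integrable_def)
    have "(\<lambda>\<omega>. sphere_inner (Xt \<omega>) (e i)) \<in> borel_measurable M"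
      "x0 i \<in> borel_measurable M" "j i \<in> borel_measurable M" if "i \<in> ?I" for i
      using L2_rv_sphere(2)[OF X e_L2[OF sh_band_index[OF that]]]
        x0_sq[OF sh_band_index[OF that]] j_sq[OF sh_band_index[OF that]]
      by (simp_all add: square_integrable_def)
    then have "(\<lambda>\<omega>. sqrt ((sphere_norm (Xt \<omega>))\<^sup>2
        - 2 * (\<Sum>i\<in>?I. (x0 i \<omega> + j i \<omega>) * sphere_inner (Xt \<omega>) (e i))
        + (\<Sum>i\<in>?I. (x0 i \<omega> + j i \<omega>)\<^sup>2))) \<in> borel_measurable M"
      by (intro measurable_compose[OF _ borel_measurable_sqrt] borel_measurable_add borel_measurable_diff borel_measurable_sum
          borel_measurable_times borel_measurable_const borel_measurable_power) auto
    then show "err n \<in> borel_measurable M"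
      by (subst measurable_cong[OF eq])
    show "\<bar>err n \<omega>\<bar> \<le> sphere_norm (Xt \<omega>) + (\<Sum>i\<in>?I. \<bar>x0 i \<omega> + j i \<omega>\<bar>)"
      if "\<omega> \<in> space M" for \<omega>
    proof -
      have "err n \<omega> \<le> l2norm sphere_measure (Xt \<omega>)
          + l2norm sphere_measure (\<lambda>x. - 1 * spectral_approx Y X0 J n t \<omega> x)"
        using l2norm_triangle[OF Xt_sq[OF that] square_integrable_cmult[OF approx_sq, of "- 1" n \<omega>]]
        by (simp add: err_def sphere_norm_eq_l2norm fun_diff_def)
      also have "l2norm sphere_measure (\<lambda>x. - 1 * spectral_approx Y X0 J n t \<omega> x) =
          L2_set (\<lambda>i. x0 i \<omega> + j i \<omega>) ?I"
        by (subst l2norm_cmult) (simp add: approx[abs_def] approx_norm)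
      also have "\<dots> \<le> (\<Sum>i\<in>?I. \<bar>x0 i \<omega> + j i \<omega>\<bar>)" by (rule L2_set_le_sum_abs)
      finally show ?thesis by (simp add: err_def sphere_norm_eq_l2norm)
    qed
  qed
  have tailj_sq: "square_integrable M (tailj n)"
    and tailj_norm: "l2norm M (tailj n) \<le> R" for n
  proof -
    let ?I = "sh_band {\<kappa><..n}"
    have int: "integrable M (\<lambda>\<omega>. (j i \<omega>)\<^sup>2)" "j i \<in> borel_measurable M" if "i \<in> ?I" for i
      using j_sq[OF sh_band_index[OF that]] by (simp_all add: square_integrable_def)
    have sq: "(tailj n \<omega>)\<^sup>2 = (\<Sum>i\<in>?I. (j i \<omega>)\<^sup>2)" for \<omega>
      by (simp add: tailj_def L2_set_def sum_nonneg)
    have "tailj n \<in> borel_measurable M"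
      unfolding tailj_def[abs_def] L2_set_def
      by (intro measurable_compose[OF _ borel_measurable_sqrt] borel_measurable_sum borel_measurable_power int)
    then show "square_integrable M (tailj n)"
      by (simp add: square_integrable_def sq int)
    have "(l2norm M (tailj n))\<^sup>2 = (\<Sum>i\<in>?I. \<integral>\<omega>. (j i \<omega>)\<^sup>2 \<partial>M)"
      unfolding l2norm_sq sq by (simp add: int)
    also have "\<dots> \<le> (\<Sum>(l, m)\<in>?I. q l m)"
      by (rule sum_mono) (auto simp: j_def sh_band_def intro!: J_le)
    also have "\<dots> \<le> R\<^sup>2" by (rule q)
    finally show "l2norm M (tailj n) \<le> R" using R by (rule power2_le_imp_le)
  qed
  have err_le: "err \<kappa> \<omega> \<le> (err n \<omega> + E * sphere_norm (X0 \<omega>)) + tailj n \<omega>"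
    if n: "\<kappa> \<le> n" and \<omega>: "\<omega> \<in> space M" for n \<omega>
  proof -
    let ?I = "sh_band {\<kappa><..n}"
    have X0_sq: "square_integrable sphere_measure (X0 \<omega>)"
      using L2_rv_in_space[OF X0 \<omega>] by (simp add: L2_sphere_iff)
    have "spectral_approx Y X0 J n t \<omega> x - spectral_approx Y X0 J \<kappa> t \<omega> x =
        (\<Sum>i\<in>?I. (x0 i \<omega> + j i \<omega>) * e i x)" for x
    proof -
      have "sh_band {..n} = sh_band {..\<kappa>} \<union> ?I" "sh_band {..\<kappa>} \<inter> ?I = {}"
        using n by (auto simp: sh_band_def)
      then show ?thesis unfolding approx by (simp add: sum.union_disjoint)
    qed
    then have diff: "l2norm sphere_measure
        (\<lambda>x. spectral_approx Y X0 J n t \<omega> x - spectral_approx Y X0 J \<kappa> t \<omega> x) =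
        L2_set (\<lambda>i. x0 i \<omega> + j i \<omega>) ?I"
      by (simp add: approx_norm)
    have "err \<kappa> \<omega> = l2norm sphere_measure (\<lambda>x.
        (Xt \<omega> x - spectral_approx Y X0 J n t \<omega> x) +
        (spectral_approx Y X0 J n t \<omega> x - spectral_approx Y X0 J \<kappa> t \<omega> x))"
      by (simp add: err_def sphere_norm_eq_l2norm fun_diff_def)
    also have "\<dots> \<le> err n \<omega> + L2_set (\<lambda>i. x0 i \<omega> + j i \<omega>) ?I"
      unfolding diff[symmetric] err_def sphere_norm_eq_l2norm fun_diff_def
      by (intro l2norm_triangle square_integrable_diff Xt_sq[OF \<omega>] approx_sq)
    also have "L2_set (\<lambda>i. x0 i \<omega> + j i \<omega>) ?I \<le> L2_set (\<lambda>i. x0 i \<omega>) ?I + tailj n \<omega>"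
      unfolding tailj_def by (rule L2_set_triangle_ineq)
    also have "L2_set (\<lambda>i. x0 i \<omega>) ?I \<le> L2_set (\<lambda>i. E * sphere_inner (X0 \<omega>) (e i)) ?I"
    proof -
      have "\<bar>x0 i \<omega>\<bar> \<le> E * \<bar>sphere_inner (X0 \<omega>) (e i)\<bar>" if "i \<in> ?I" for i
      proof -
        obtain l m where i: "i = (l, m)" by (cases i)
        have "real \<kappa> + 1 \<le> real l" using that by (auto simp: i sh_band_def)
        then have "(real \<kappa> + 1)\<^sup>2 \<le> sh_eigenvalue l"
          unfolding power2_eq_square sh_eigenvalue_def by (intro mult_mono) auto
        then have "exp (- sh_eigenvalue l * t) \<le> E"
          using t by (simp add: E_def mult_right_mono)
        then show ?thesis by (simp add: i x0_def e_def abs_mult mult_right_mono)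
      qed
      then show ?thesis
        unfolding L2_set_def
        by (intro real_sqrt_le_mono sum_mono abs_le_square_iff[THEN iffD1])
          (simp add: abs_mult E_def)
    qed
    also have "\<dots> = E * L2_set (\<lambda>i. sphere_inner (X0 \<omega>) (e i)) ?I"
      by (simp add: L2_set_right_distrib E_def)
    also have "\<dots> \<le> E * sphere_norm (X0 \<omega>)"
      using Bessel_inequality[of ?I sphere_measure "X0 \<omega>" e, OF _ X0_sq e_sq e_orth]
      by (intro mult_left_mono) (auto simp: sphere_inner_def sphere_norm_eq_l2norm E_def)
    finally show ?thesis by simp
  qed
  have bound: "l2norm M (err \<kappa>) \<le> l2norm M (err n) + (E * L2_norm M sphere_norm X0 + R)"
    if n: "\<kappa> \<le> n" for n
  proof -
    have EX0: "square_integrable M (\<lambda>\<omega>. E * sphere_norm (X0 \<omega>))"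
      by (rule square_integrable_cmult[OF L2_rv_sphere(1)[OF X0]])
    have "l2norm M (err \<kappa>) \<le> l2norm M (\<lambda>\<omega>. err n \<omega> + E * sphere_norm (X0 \<omega>)) + l2norm M (tailj n)"
      using err_le[OF n]
      by (intro l2norm_le_sum square_integrable_add err_sq EX0 tailj_sq) (simp add: err_def)
    moreover have "l2norm M (\<lambda>\<omega>. err n \<omega> + E * sphere_norm (X0 \<omega>)) \<le>
        l2norm M (err n) + l2norm M (\<lambda>\<omega>. E * sphere_norm (X0 \<omega>))"
      by (rule l2norm_triangle[OF err_sq EX0])
    moreover have "l2norm M (\<lambda>\<omega>. E * sphere_norm (X0 \<omega>)) = E * L2_norm M sphere_norm X0"
      by (simp add: l2norm_cmult L2_norm_eq_l2norm E_def)
    ultimately show ?thesis using tailj_norm[of n] by linarith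
  qed
  have err_norm: "L2_norm M sphere_norm (\<lambda>\<omega>. Xt \<omega> - spectral_approx Y X0 J n t \<omega>) = l2norm M (err n)"
    for n by (simp add: L2_norm_eq_l2norm err_def[abs_def])
  have "(\<lambda>n. l2norm M (err n) + (E * L2_norm M sphere_norm X0 + R)) \<longlonglongrightarrow>
      0 + (E * L2_norm M sphere_norm X0 + R)"
    using X_series unfolding err_norm
    by (intro tendsto_add tendsto_const)
  then have "l2norm M (err \<kappa>) \<le> 0 + (E * L2_norm M sphere_norm X0 + R)"
    by (rule LIMSEQ_le_const) (use bound in blast)
  then show ?thesis by (simp add: err_norm E_def)
qed

lemma sh_eigenvalue_nonneg: "0 \<le> sh_eigenvalue l"
  by (simp add: sh_eigenvalue_def)

text \<open>A single weighted squared coefficient is dominated by the squared Sobolev norm.\<close>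
lemma sobolev_coefficient_square_integrable:
  assumes Z: "L2_rv M (sobolev_space \<eta>) (sobolev_norm \<eta>) Z"
    and i: "(l, m) \<in> sh_index" and meas: "(\<lambda>\<omega>. Z \<omega> l m) \<in> borel_measurable M"
  shows "square_integrable M (\<lambda>\<omega>. Z \<omega> l m)"
proof -
  have w: "0 < sobolev_weight \<eta> l'" for l'
    using sh_eigenvalue_nonneg[of l'] by (simp add: sobolev_weight_def)
  have bound: "sobolev_weight \<eta> l * (Z \<omega> l m)\<^sup>2 \<le> (sobolev_norm \<eta> (Z \<omega>))\<^sup>2"
    if "\<omega> \<in> space M" for \<omega>
  proof -
    let ?g = "\<lambda>(l, m). sobolev_weight \<eta> l * (Z \<omega> l m)\<^sup>2"
    have g0: "0 \<le> ?g k" for k using w[of "fst k"] by (simp add: case_prod_beta)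
    have "?g summable_on sh_index"
      using L2_rv_in_space[OF Z that] by (simp add: sobolev_space_def)
    then have "sum ?g {(l, m)} \<le> infsum ?g sh_index"
      using i g0 by (intro finite_sum_le_infsum) auto
    moreover have "0 \<le> infsum ?g sh_index" by (rule infsum_nonneg) (rule g0)
    ultimately show ?thesis by (simp add: sobolev_norm_def)
  qed
  have "integrable M (\<lambda>\<omega>. sobolev_weight \<eta> l * (Z \<omega> l m)\<^sup>2)"
  proof (rule Bochner_Integration.integrable_bound)
    show "integrable M (\<lambda>\<omega>. (sobolev_norm \<eta> (Z \<omega>))\<^sup>2)" using Z by (simp add: L2_rv_def)
    show "AE \<omega> in M. norm (sobolev_weight \<eta> l * (Z \<omega> l m)\<^sup>2) \<le> norm ((sobolev_norm \<eta> (Z \<omega>))\<^sup>2)"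
      using bound w[of l] by (auto simp: abs_mult)
  qed (use meas in measurable)
  then show ?thesis using meas w[of l] by (simp add: square_integrable_def)
qed

section \<open>Decay of the tail sums\<close>

text \<open>By the mean value theorem, the terms are at most those of the telescoping sum of
  \<open>((l - 1) powr (- \<alpha>) - l powr (- \<alpha>)) / \<alpha>\<close>.\<close>
lemma sum_powr_tail_le:
  assumes \<alpha>: "\<alpha> > 0" and \<kappa>: "1 \<le> \<kappa>"
  shows "(\<Sum>l\<in>{\<kappa><..n}. real l powr (- \<alpha> - 1)) \<le> real \<kappa> powr (- \<alpha>) / \<alpha>"
proof -
  have tele: "real (Suc l) powr (- \<alpha> - 1) \<le> (real l powr (- \<alpha>) - real (Suc l) powr (- \<alpha>)) / \<alpha>"
    if "1 \<le> l" for l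
  proof -
    have "\<exists>z. real l < z \<and> z < real (Suc l) \<and>
        real (Suc l) powr (- \<alpha>) - real l powr (- \<alpha>) =
        (real (Suc l) - real l) * (- \<alpha> * z powr (- \<alpha> - 1))"
    proof (rule MVT2)
      fix x assume "real l \<le> x"
      then have "0 < x" using that by simp
      then show "((\<lambda>x. x powr (- \<alpha>)) has_real_derivative - \<alpha> * x powr (- \<alpha> - 1)) (at x)"
        by (rule has_real_derivative_powr)
    qed simp
    then obtain z where z: "real l < z" "z < real (Suc l)"
      and eq: "real l powr (- \<alpha>) - real (Suc l) powr (- \<alpha>) = \<alpha> * z powr (- \<alpha> - 1)"
      by auto
    have "real (Suc l) powr (- \<alpha> - 1) \<le> z powr (- \<alpha> - 1)"
      using z that \<alpha> by (intro powr_mono2') auto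
    then show ?thesis using eq \<alpha> by (simp add: field_simps)
  qed
  show ?thesis
  proof (cases "\<kappa> \<le> n")
    case True
    have "(\<Sum>l\<in>{\<kappa><..n}. real l powr (- \<alpha> - 1)) \<le>
        (real \<kappa> powr (- \<alpha>) - real n powr (- \<alpha>)) / \<alpha>"
      using True
    proof (induction n rule: dec_induct)
      case (step n)
      have "{\<kappa><..Suc n} = insert (Suc n) {\<kappa><..n}" using step.hyps by auto
      then show ?case
        using step.IH \<open>1 \<le> \<kappa>\<close> step.hyps tele[of n]
        by (simp add: diff_divide_distrib)
    qed simp
    also have "\<dots> \<le> real \<kappa> powr (- \<alpha>) / \<alpha>" using \<alpha> by (simp add: divide_right_mono)
    finally show ?thesis .
  qed (use \<alpha> in auto)
qed

text \<open>
  For degrees \<open>l > \<kappa> \<ge> 1\<close> the eigenvalue is at least \<open>\<kappa>\<^sup>2 \<ge> 1\<close>, so \<open>1 / (2 \<lambda>) \<le> 1 / (1 + \<lambda>)\<close>, and smoothness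
  \<open>\<eta> > -1\<close> lets the excess factor \<open>(1 + \<lambda>) powr - (\<eta> + 1)\<close> be estimated at \<open>\<kappa>\<^sup>2\<close>.
\<close>
lemma tail_sum_Sobolev:
  fixes v mu :: "nat \<Rightarrow> int \<Rightarrow> real"
  assumes \<eta>: "-1 < \<eta>" and \<kappa>: "1 \<le> \<kappa>"
    and v: "\<And>l m. (l, m) \<in> sh_index \<Longrightarrow> 0 \<le> v l m"
    and summable: "(\<lambda>(l, m). (1 + sh_eigenvalue l) powr \<eta> * (v l m + (mu l m)\<^sup>2)) summable_on sh_index"
  shows "(\<Sum>(l, m)\<in>sh_band {\<kappa><..n}. (v l m + T * (mu l m)\<^sup>2) / (2 * sh_eigenvalue l)) \<le>
    (sqrt (max 1 T * (\<Sum>\<^sub>\<infinity>(l, m)\<in>sh_index. (1 + sh_eigenvalue l) powr \<eta> * (v l m + (mu l m)\<^sup>2)))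
      * real \<kappa> powr - (\<eta> + 1))\<^sup>2"
proof -
  define g where "g = (\<lambda>(l, m). (1 + sh_eigenvalue l) powr \<eta> * (v l m + (mu l m)\<^sup>2))"
  define b where "b = max 1 T * (real \<kappa> powr - (\<eta> + 1))\<^sup>2"
  have b: "0 \<le> b" by (simp add: b_def)
  have g0: "0 \<le> g i" if "i \<in> sh_index" for i
    using v that by (cases i) (auto simp: g_def intro!: mult_nonneg_nonneg add_nonneg_nonneg)
  have term_le: "(v l m + T * (mu l m)\<^sup>2) / (2 * sh_eigenvalue l) \<le> b * g (l, m)"
    if "(l, m) \<in> sh_band {\<kappa><..n}" for l m
  proof -
    have l: "\<kappa> < l" using that by (simp add: sh_band_def)
    have "real \<kappa> * real \<kappa> \<le> real l * (real l + 1)"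
      using l by (intro mult_mono) auto
    then have ev: "(real \<kappa>)\<^sup>2 \<le> sh_eigenvalue l" by (simp add: sh_eigenvalue_def power2_eq_square)
    have "1 \<le> (real \<kappa>)\<^sup>2" using \<kappa> by simp
    with ev have ev1: "1 \<le> sh_eigenvalue l" by linarith
    have v0: "0 \<le> v l m" by (rule v[OF sh_band_index[OF that]])
    have "v l m + T * (mu l m)\<^sup>2 \<le> max 1 T * v l m + max 1 T * (mu l m)\<^sup>2"
      using mult_right_mono[of 1 "max 1 T" "v l m"] v0
        mult_right_mono[of T "max 1 T" "(mu l m)\<^sup>2"] by simp
    then have num: "v l m + T * (mu l m)\<^sup>2 \<le> max 1 T * (v l m + (mu l m)\<^sup>2)"
      by (simp add: distrib_left)
    have nonneg: "0 \<le> max 1 T * (v l m + (mu l m)\<^sup>2)"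
      using v0 by (intro mult_nonneg_nonneg add_nonneg_nonneg) auto
    have "(v l m + T * (mu l m)\<^sup>2) / (2 * sh_eigenvalue l) \<le>
        max 1 T * (v l m + (mu l m)\<^sup>2) / (2 * sh_eigenvalue l)"
      using num ev1 by (intro divide_right_mono) auto
    also have "\<dots> \<le> max 1 T * (v l m + (mu l m)\<^sup>2) / (1 + sh_eigenvalue l)"
      using nonneg ev1 by (intro divide_left_mono) auto
    also have "\<dots> = max 1 T * (1 + sh_eigenvalue l) powr - (\<eta> + 1) * g (l, m)"
    proof -
      have "(1 + sh_eigenvalue l) powr - (\<eta> + 1) * (1 + sh_eigenvalue l) powr \<eta> =
          (1 + sh_eigenvalue l) powr (- 1)"
        by (simp flip: powr_add)
      also have "\<dots> = 1 / (1 + sh_eigenvalue l)"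
        using ev1 by (simp add: powr_minus_divide)
      finally have "x / (1 + sh_eigenvalue l) =
          x * ((1 + sh_eigenvalue l) powr - (\<eta> + 1) * (1 + sh_eigenvalue l) powr \<eta>)" for x
        by simp
      then show ?thesis by (simp only: g_def prod.case mult_ac)
    qed
    also have "\<dots> \<le> max 1 T * ((real \<kappa>)\<^sup>2) powr - (\<eta> + 1) * g (l, m)"
      using ev \<kappa> \<eta> g0[OF sh_band_index[OF that]]
      by (intro mult_right_mono mult_left_mono powr_mono2') auto
    also have "((real \<kappa>)\<^sup>2) powr - (\<eta> + 1) = (real \<kappa> powr - (\<eta> + 1))\<^sup>2"
      using \<kappa> by (simp add: power2_eq_square powr_mult)
    finally show ?thesis by (simp add: b_def)
  qed
  have "(\<Sum>(l, m)\<in>sh_band {\<kappa><..n}. (v l m + T * (mu l m)\<^sup>2) / (2 * sh_eigenvalue l)) \<le>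
      (\<Sum>i\<in>sh_band {\<kappa><..n}. b * g i)"
    by (intro sum_mono) (auto intro: term_le)
  also have "\<dots> = b * sum g (sh_band {\<kappa><..n})" by (simp add: sum_distrib_left)
  also have "\<dots> \<le> b * infsum g sh_index"
    using summable g0
    by (intro mult_left_mono finite_sum_le_infsum b) (auto simp: g_def intro: sh_band_index)
  also have "\<dots> = (sqrt (max 1 T * infsum g sh_index) * real \<kappa> powr - (\<eta> + 1))\<^sup>2"
    using infsum_nonneg[of sh_index g] g0 by (simp add: b_def power_mult_distrib)
  finally show ?thesis by (simp add: g_def)
qed

text \<open>The \<open>2 l + 1\<close> orders of degree \<open>l\<close> consume one of the two powers of \<open>l\<close> in the eigenvalue.\<close>
lemma tail_sum_powr:
  fixes v mu :: "nat \<Rightarrow> int \<Rightarrow> real"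
  assumes \<alpha>: "0 < \<alpha>" and \<kappa>: "1 \<le> \<kappa>" and B: "0 \<le> B"
    and le: "\<And>l m. (l, m) \<in> sh_index \<Longrightarrow> 1 \<le> l \<Longrightarrow> v l m + T * (mu l m)\<^sup>2 \<le> B * real l powr - \<alpha>"
  shows "(\<Sum>(l, m)\<in>sh_band {\<kappa><..n}. (v l m + T * (mu l m)\<^sup>2) / (2 * sh_eigenvalue l)) \<le>
    (sqrt (B / \<alpha>) * real \<kappa> powr - (\<alpha> / 2))\<^sup>2"
proof -
  have "(\<Sum>(l, m)\<in>sh_band {\<kappa><..n}. (v l m + T * (mu l m)\<^sup>2) / (2 * sh_eigenvalue l)) =
      (\<Sum>l\<in>{\<kappa><..n}. \<Sum>m=-int l..int l. (v l m + T * (mu l m)\<^sup>2) / (2 * sh_eigenvalue l))"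
    by (subst sum_sh_band) auto
  also have "\<dots> \<le> (\<Sum>l\<in>{\<kappa><..n}. B * real l powr (- \<alpha> - 1))"
  proof (rule sum_mono)
    fix l assume "l \<in> {\<kappa><..n}"
    then have l: "1 \<le> l" using \<kappa> by auto
    then have ev: "0 < sh_eigenvalue l" by (simp add: sh_eigenvalue_def)
    have "(\<Sum>m=-int l..int l. (v l m + T * (mu l m)\<^sup>2) / (2 * sh_eigenvalue l)) \<le>
        (\<Sum>m=-int l..int l. B * real l powr - \<alpha> / (2 * sh_eigenvalue l))"
      using ev l by (intro sum_mono divide_right_mono le) (auto simp: sh_index_def)
    also have "\<dots> = (2 * real l + 1) * (B * real l powr - \<alpha> / (2 * sh_eigenvalue l))"
      by simp
    also have "\<dots> = (B * real l powr - \<alpha>) * ((2 * real l + 1) / (2 * (real l + 1)) / real l)"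
      using l by (simp add: sh_eigenvalue_def field_simps)
    also have "\<dots> \<le> (B * real l powr - \<alpha>) * (1 / real l)"
      using l B by (intro mult_left_mono divide_right_mono) (auto simp: field_simps)
    also have "\<dots> = B * real l powr (- \<alpha> - 1)"
      using l by (simp add: powr_diff)
    finally show "(\<Sum>m=-int l..int l. (v l m + T * (mu l m)\<^sup>2) / (2 * sh_eigenvalue l)) \<le>
        B * real l powr (- \<alpha> - 1)" .
  qed
  also have "\<dots> \<le> B * (real \<kappa> powr - \<alpha> / \<alpha>)"
    unfolding sum_distrib_left[symmetric]
    by (intro mult_left_mono sum_powr_tail_le \<alpha> \<kappa> B)
  also have "\<dots> = (sqrt (B / \<alpha>) * real \<kappa> powr - (\<alpha> / 2))\<^sup>2"
  proof -
    have "(real \<kappa> powr - (\<alpha> / 2))\<^sup>2 = real \<kappa> powr - \<alpha>"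
      by (simp add: power2_eq_square flip: powr_add)
    then show ?thesis using B \<alpha> by (simp add: power_mult_distrib)
  qed
  finally show ?thesis .
qed

section \<open>Convergence of the spectral approximation\<close>

theorem theorem3p1:
  fixes M :: "'w measure" and F :: "real \<Rightarrow> 'w measure" and T \<eta>\<^sub>0 \<beta> :: real
    and Y :: "nat \<Rightarrow> int \<Rightarrow> real^3 \<Rightarrow> real"
    and L :: "real \<Rightarrow> 'w \<Rightarrow> nat \<Rightarrow> int \<Rightarrow> real"
    and mu v :: "nat \<Rightarrow> int \<Rightarrow> real"
    and X0 :: "'w \<Rightarrow> real^3 \<Rightarrow> real"
    and J :: "nat \<Rightarrow> int \<Rightarrow> real \<Rightarrow> 'w \<Rightarrow> real"
    and X :: "real \<Rightarrow> 'w \<Rightarrow> real^3 \<Rightarrow> real"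
  assumes T: "0 \<le> T"
    and filtered: "complete_filtered_prob_space M T F"
    and harmonics: "real_spherical_harmonics Y"
    and eta0: "\<eta>\<^sub>0 > -1"
    and levy: "levy_process M (sobolev_space \<eta>\<^sub>0) (sobolev_norm \<eta>\<^sub>0) L"
    and levy_L2: "\<forall>t\<ge>0. L2_rv M (sobolev_space \<eta>\<^sub>0) (sobolev_norm \<eta>\<^sub>0) (L t)"
    and levy_coeff: "\<forall>(l, m)\<in>sh_index. real_levy_process M (\<lambda>t \<omega>. L t \<omega> l m)"
    and mean_def: "\<forall>(l, m)\<in>sh_index. mu l m = (\<integral>\<omega>. L 1 \<omega> l m \<partial>M)"
    and var_def: "\<forall>(l, m)\<in>sh_index. v l m = (\<integral>\<omega>. (L 1 \<omega> l m - mu l m)\<^sup>2 \<partial>M)"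
    and X0_L2: "L2_rv M L2_sphere sphere_norm X0"
    and X0_F0: "X0 \<in> measurable (F 0) (norm_borel L2_sphere sphere_norm)"
    and X0_indep: "rv_indep_of_process M (norm_borel L2_sphere sphere_norm) X0
                     (norm_borel (sobolev_space \<eta>\<^sub>0) (sobolev_norm \<eta>\<^sub>0)) L"
    and J: "\<forall>(l, m)\<in>sh_index. \<forall>t\<in>{0..T}.
              has_stoch_integral M (\<lambda>s \<omega>. L s \<omega> l m) t
                (\<lambda>s. exp (- sh_eigenvalue l * (t - s))) (J l m t)"
    and X_L2: "\<forall>t\<in>{0..T}. L2_rv M L2_sphere sphere_norm (X t)"
    and X_series: "\<forall>t\<in>{0..T}.
              (\<lambda>n. L2_norm M sphere_norm (\<lambda>\<omega>. X t \<omega> - spectral_approx Y X0 J n t \<omega>)) \<longlonglongrightarrow> 0"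
    and noise:
      "(\<exists>\<eta>>-1.
          (\<lambda>(l, m). (1 + sh_eigenvalue l) powr \<eta> * (v l m + (mu l m)\<^sup>2)) summable_on sh_index \<and>
          \<beta> = \<eta> + 1)
       \<or>
       (\<exists>\<alpha>>0. \<exists>a C' Lhat mhat vhat.
          a 0 \<ge> 0 \<and>
          (\<forall>l\<ge>1. \<bar>a l\<bar> \<le> C' * real l powr (- \<alpha> / 2)) \<and>
          (\<forall>(l, m)\<in>sh_index. \<forall>t\<ge>0. AE \<omega> in M. L t \<omega> l m = a l * Lhat l m t \<omega>) \<and>
          (\<forall>(l, m)\<in>sh_index. real_levy_process M (Lhat l m)) \<and>
          (\<forall>(l, m)\<in>sh_index. \<forall>(l', m')\<in>sh_index.
             identically_distributed M (Lhat l m) (Lhat l' m')) \<and>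
          (\<forall>(l, m)\<in>sh_index. \<forall>t\<ge>0.
             integrable M (\<lambda>\<omega>. (Lhat l m t \<omega>)\<^sup>2) \<and>
             (\<integral>\<omega>. Lhat l m t \<omega> \<partial>M) = t * mhat \<and>
             (\<integral>\<omega>. (Lhat l m t \<omega> - (\<integral>\<omega>'. Lhat l m t \<omega>' \<partial>M))\<^sup>2 \<partial>M) = t * vhat) \<and>
          \<beta> = \<alpha> / 2)"
  shows "\<exists>C :: real. \<forall>\<kappa>::nat. \<kappa> \<ge> 1 \<longrightarrow> (\<forall>t\<in>{0..T}.
           L2_norm M sphere_norm (\<lambda>\<omega>. X t \<omega> - spectral_approx Y X0 J \<kappa> t \<omega>)
             \<le> exp (- (real \<kappa> + 1)\<^sup>2 * t) * L2_norm M sphere_norm X0 + C * real \<kappa> powr (- \<beta>))"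
proof -
  interpret prob_space M using filtered by (simp add: complete_filtered_prob_space_def)
  have coeff_levy: "real_levy_process M (\<lambda>t \<omega>. L t \<omega> l m)" if "(l, m) \<in> sh_index" for l m
    using levy_coeff that by blast
  have coeff_sq: "square_integrable M (\<lambda>\<omega>. L t \<omega> l m)" if "(l, m) \<in> sh_index" "0 \<le> t" for l m t
  proof (rule sobolev_coefficient_square_integrable)
    show "L2_rv M (sobolev_space \<eta>\<^sub>0) (sobolev_norm \<eta>\<^sub>0) (L t)" using levy_L2 that by blast
    show "(\<lambda>\<omega>. L t \<omega> l m) \<in> borel_measurable M"
      using coeff_levy[OF that(1)] that(2) unfolding levy_process_def norm_borel_real by blast
  qed (rule that)
  have mean: "mu l m = expectation (\<lambda>\<omega>. L 1 \<omega> l m)" if "(l, m) \<in> sh_index" for l m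
    using mean_def that by blast
  have var: "v l m = variance (\<lambda>\<omega>. L 1 \<omega> l m)" if "(l, m) \<in> sh_index" for l m
    using var_def that mean[OF that] by fastforce
  have v0: "0 \<le> v l m" if "(l, m) \<in> sh_index" for l m
    unfolding var[OF that] by (rule variance_positive)
  define q where "q l m = (v l m + T * (mu l m)\<^sup>2) / (2 * sh_eigenvalue l)" for l m
  have J_int: "has_stoch_integral M (\<lambda>s \<omega>. L s \<omega> l m) t
      (\<lambda>s. exp (- sh_eigenvalue l * (t - s))) (J l m t)"
    if "(l, m) \<in> sh_index" "t \<in> {0..T}" for l m t
    using J that by blast
  have J_sq: "square_integrable M (J l m t)" if "(l, m) \<in> sh_index" "t \<in> {0..T}" for l m t
    using J_int[OF that] unfolding has_stoch_integral_def square_integrable_def by (elim conjE) simp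
  have J_le: "expectation (\<lambda>\<omega>. (J l m t \<omega>)\<^sup>2) \<le> q l m"
    if i: "(l, m) \<in> sh_index" and t: "t \<in> {0..T}" and l: "1 \<le> l" for l m t
    unfolding q_def mean[OF i] var[OF i]
  proof (rule stoch_convolution_second_moment[OF coeff_levy[OF i] coeff_sq[OF i] _ _ _ J_int[OF i t]])
    show "0 < sh_eigenvalue l" using l by (simp add: sh_eigenvalue_def)
  qed (use t in auto)
  \<comment> \<open>Both assumptions on the noise enter only through the decay of the tail sums of \<open>q\<close>.\<close>
  have conclusion: ?thesis
    if D: "0 \<le> D" and tail: "\<And>\<kappa> n. 1 \<le> \<kappa> \<Longrightarrow>
        (\<Sum>(l, m)\<in>sh_band {\<kappa><..n}. q l m) \<le> (D * real \<kappa> powr - \<beta>)\<^sup>2" for D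
  proof (intro exI[of _ D] allI impI ballI)
    fix \<kappa> :: nat and t assume \<kappa>: "1 \<le> \<kappa>" and t: "t \<in> {0..T}"
    show "L2_norm M sphere_norm (\<lambda>\<omega>. X t \<omega> - spectral_approx Y X0 J \<kappa> t \<omega>)
        \<le> exp (- (real \<kappa> + 1)\<^sup>2 * t) * L2_norm M sphere_norm X0 + D * real \<kappa> powr (- \<beta>)"
    proof (rule spectral_error_le[OF harmonics X0_L2])
      show "L2_rv M L2_sphere sphere_norm (X t)" using X_L2 t by blast
      show "square_integrable M (J l m t)" if "(l, m) \<in> sh_index" for l m
        by (rule J_sq[OF that t])
      show "expectation (\<lambda>\<omega>. (J l m t \<omega>)\<^sup>2) \<le> q l m" if "(l, m) \<in> sh_band {\<kappa><..}" for l m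
        using that \<kappa> by (intro J_le t sh_band_index[OF that]) (auto simp: sh_band_def)
      show "(\<lambda>n. L2_norm M sphere_norm (\<lambda>\<omega>. X t \<omega> - spectral_approx Y X0 J n t \<omega>)) \<longlonglongrightarrow> 0"
        using X_series t by blast
    qed (use t D tail[OF \<kappa>] in auto)
  qed
  from noise show ?thesis
  proof (elim disjE exE conjE)
    fix \<eta> :: real
    assume \<eta>: "-1 < \<eta>" and \<beta>: "\<beta> = \<eta> + 1"
      and summable: "(\<lambda>(l, m). (1 + sh_eigenvalue l) powr \<eta> * (v l m + (mu l m)\<^sup>2)) summable_on sh_index"
    show ?thesis
    proof (rule conclusion)
      show "(\<Sum>(l, m)\<in>sh_band {\<kappa><..n}. q l m) \<le>
          (sqrt (max 1 T * (\<Sum>\<^sub>\<infinity>(l, m)\<in>sh_index. (1 + sh_eigenvalue l) powr \<eta> * (v l m + (mu l m)\<^sup>2)))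
            * real \<kappa> powr - \<beta>)\<^sup>2" if "1 \<le> \<kappa>" for \<kappa> n
        unfolding q_def \<beta> by (rule tail_sum_Sobolev[OF \<eta> that v0 summable])
      show "0 \<le> sqrt (max 1 T *
          (\<Sum>\<^sub>\<infinity>(l, m)\<in>sh_index. (1 + sh_eigenvalue l) powr \<eta> * (v l m + (mu l m)\<^sup>2)))"
        using v0 by (auto intro!: mult_nonneg_nonneg infsum_nonneg add_nonneg_nonneg)
    qed
  next
    fix \<alpha> mhat vhat C' :: real and a :: "nat \<Rightarrow> real" and Lhat :: "nat \<Rightarrow> int \<Rightarrow> real \<Rightarrow> 'w \<Rightarrow> real"
    assume \<alpha>: "0 < \<alpha>" and \<beta>: "\<beta> = \<alpha> / 2"
      and a: "\<forall>l\<ge>1. \<bar>a l\<bar> \<le> C' * real l powr (- \<alpha> / 2)"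
      and L_eq: "\<forall>(l, m)\<in>sh_index. \<forall>t\<ge>0. AE \<omega> in M. L t \<omega> l m = a l * Lhat l m t \<omega>"
      and hat: "\<forall>(l, m)\<in>sh_index. \<forall>t\<ge>0.
             integrable M (\<lambda>\<omega>. (Lhat l m t \<omega>)\<^sup>2) \<and>
             (\<integral>\<omega>. Lhat l m t \<omega> \<partial>M) = t * mhat \<and>
             (\<integral>\<omega>. (Lhat l m t \<omega> - (\<integral>\<omega>'. Lhat l m t \<omega>' \<partial>M))\<^sup>2 \<partial>M) = t * vhat"
      and hat_levy: "\<forall>(l, m)\<in>sh_index. real_levy_process M (Lhat l m)"
    have hat_mean: "expectation (Lhat l m 1) = mhat" and hat_var: "variance (Lhat l m 1) = vhat"
      and hat_meas: "Lhat l m 1 \<in> borel_measurable M"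
      and L1: "AE \<omega> in M. L 1 \<omega> l m = a l * Lhat l m 1 \<omega>"
      if "(l, m) \<in> sh_index" for l m
    proof -
      show "AE \<omega> in M. L 1 \<omega> l m = a l * Lhat l m 1 \<omega>"
        using bspec[OF L_eq that] by simp
      show "Lhat l m 1 \<in> borel_measurable M"
        using bspec[OF hat_levy that] by (simp add: levy_process_def norm_borel_real)
      show "expectation (Lhat l m 1) = mhat" "variance (Lhat l m 1) = vhat"
        using bspec[OF hat that, unfolded prod.case, rule_format, of 1] by auto
    qed
    have mu_eq: "mu l m = a l * mhat" if "(l, m) \<in> sh_index" for l m
    proof -
      have "mu l m = expectation (\<lambda>\<omega>. a l * Lhat l m 1 \<omega>)"
        unfolding mean[OF that] using coeff_sq[OF that, of 1] hat_meas[OF that] L1[OF that]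
        by (intro integral_cong_AE) (auto simp: square_integrable_def)
      then show ?thesis using hat_mean[OF that] by simp
    qed
    have v_eq: "v l m = (a l)\<^sup>2 * vhat" if "(l, m) \<in> sh_index" for l m
    proof -
      have "v l m = expectation (\<lambda>\<omega>. (a l * Lhat l m 1 \<omega> - mu l m)\<^sup>2)"
        unfolding var[OF that] mean[OF that, symmetric]
        using coeff_sq[OF that, of 1] hat_meas[OF that] L1[OF that]
        by (intro integral_cong_AE) (auto simp: square_integrable_def)
      also have "\<dots> = expectation (\<lambda>\<omega>. (a l)\<^sup>2 * (Lhat l m 1 \<omega> - mhat)\<^sup>2)"
        by (simp add: mu_eq[OF that] flip: power_mult_distrib right_diff_distrib)
      finally show ?thesis using hat_var[OF that] hat_mean[OF that] by simp
    qed
    have vhat: "0 \<le> vhat"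
      using hat_var[of 0 0] variance_positive[of "Lhat 0 0 1"] by (simp add: sh_index_def)
    define B where "B = C'\<^sup>2 * (vhat + T * mhat\<^sup>2)"
    have B: "0 \<le> B" using vhat T by (simp add: B_def)
    have le: "v l m + T * (mu l m)\<^sup>2 \<le> B * real l powr - \<alpha>"
      if i: "(l, m) \<in> sh_index" and l: "1 \<le> l" for l m
    proof -
      have "(a l)\<^sup>2 \<le> (C' * real l powr (- \<alpha> / 2))\<^sup>2"
        using a l power_mono[of "\<bar>a l\<bar>" "C' * real l powr (- \<alpha> / 2)" 2] by simp
      also have "\<dots> = C'\<^sup>2 * real l powr - \<alpha>"
        by (simp add: power_mult_distrib) (simp add: power2_eq_square flip: powr_add)
      finally have "(a l)\<^sup>2 * (vhat + T * mhat\<^sup>2) \<le> C'\<^sup>2 * real l powr - \<alpha> * (vhat + T * mhat\<^sup>2)"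
        using vhat T by (intro mult_right_mono) auto
      then show ?thesis
        by (simp add: v_eq[OF i] mu_eq[OF i] B_def algebra_simps)
    qed
    show ?thesis
    proof (rule conclusion)
      show "(\<Sum>(l, m)\<in>sh_band {\<kappa><..n}. q l m) \<le> (sqrt (B / \<alpha>) * real \<kappa> powr - \<beta>)\<^sup>2"
        if "1 \<le> \<kappa>" for \<kappa> n
        unfolding q_def \<beta> by (rule tail_sum_powr[OF \<alpha> that B le])
      show "0 \<le> sqrt (B / \<alpha>)" using B \<alpha> by simp
    qed
  qed
qed

end
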